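(* Let $G$ be an Eulerian directed multigraph with $n$ vertices and $m$ edges, given with fixed orderings of incoming and outgoing edges at each vertex. Assume arithmetic and memory operations on $\lceil\lg m\rceil$-bit integers take constant time, and that $d^+(v)$, $d^-(v)$, $\Gamma^+(v,i)$ and $\Gamma^-(v,i)$ can each be evaluated in constant time. Then Algorithm \textsc{Space-Efficient-Hierholzer} (described in the context) terminates on $G$ in time $\mathrm{O}(m)$.
   Context: $G=(V,E)$ is a finite directed multigraph (loops and parallel edges allowed), $V=[n]$, $|E|=m$. $d^+(v)$, $d^-(v)$ are out- and in-degree. $G$ is Eulerian: strongly connected and $d^+(v)=d^-(v)$ for all $v$. $\Gamma^+(v,i)$ is the head of the $i$-th outgoing edge of $v$ and $\Gamma^-(v,i)$ the tail of the $i$-th incoming edge of $v$, w.r.t. arbitrary fixed orderings. Algorithm \textsc{Space-Efficient-Hierholzer}: initialise integer arrays $\texttt{next}[1..n]$, $\texttt{visited}[1..n]$, $\texttt{skipped}[1..n]$, $B[1..n]$ to all zeros and $c\gets 0$. Pick an arbitrary $v_0\in[n]$, set $u\gets v_0$ and $\texttt{visited}[u]\gets 1$. While $c<m$: set $\texttt{next}[u]\gets\texttt{next}[u]+1$ and $i\gets\texttt{next}[u]$. If $i\le d^-(u)$: let $v\gets\Gamma^-(u,i)$; if $\texttt{visited}[v]=0$ then (if $v\ne v_0$ set $B[v]\gets u$) and set $\texttt{visited}[v]\gets 1$; then set $u\gets v$. Otherwise: set $i\gets \texttt{next}[u]-d^-(u)$; if $\Gamma^+(u,i)=B[u]$ and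 $\texttt{skipped}[u]=0$, then set $\texttt{skipped}[u]\gets 1$, $\texttt{next}[u]\gets\texttt{next}[u]+1$, $i\gets i+1$ (the test is taken to be false if $i>d^+(u)$). Then if $i>d^+(u)$ let $v\gets B[u]$, else $v\gets \Gamma^+(u,i)$; write the edge $uv$ to the output, set $c\gets c+1$ and $u\gets v$. *)

theory Defs
  imports
    Complex_Main
    "HOL-Library.Monad_Syntax"
    "Graph_Theory.Digraph_Component"
begin

definition eulerian :: "('a, 'e) pre_digraph \<Rightarrow> bool" where
  "eulerian G \<longleftrightarrow> fin_digraph G \<and> strongly_connected G \<and>
     (\<forall>v \<in> verts G. out_degree G v = in_degree G v)"

record 'e ordered_digraph =
  base :: "(nat, 'e) pre_digraph"
  out_edge :: "nat \<Rightarrow> nat \<Rightarrow> 'e"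
  in_edge :: "nat \<Rightarrow> nat \<Rightarrow> 'e"

abbreviation num_verts :: "'e ordered_digraph \<Rightarrow> nat" where
  "num_verts D \<equiv> card (verts (base D))"

abbreviation num_arcs :: "'e ordered_digraph \<Rightarrow> nat" where
  "num_arcs D \<equiv> card (arcs (base D))"

text \<open>The vertex set is \<open>{1..n}\<close>, so that \<open>0\<close> is not a vertex; edges at a vertex are numbered
  from \<open>1\<close>. A loop at \<open>v\<close> occurs in both orderings at \<open>v\<close>.\<close>

definition ordered_eulerian :: "'e ordered_digraph \<Rightarrow> bool" where
  "ordered_eulerian D \<longleftrightarrow> eulerian (base D) \<and>
     verts (base D) = {1..num_verts D} \<and>
     (\<forall>v \<in> verts (base D).
        bij_betw (out_edge D v) {1..out_degree (base D) v} (out_arcs (base D) v) \<and>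
        bij_betw (in_edge D v) {1..in_degree (base D) v} (in_arcs (base D) v))"

definition Gamma_out :: "'e ordered_digraph \<Rightarrow> nat \<Rightarrow> nat \<Rightarrow> nat" where
  "Gamma_out D v i = head (base D) (out_edge D v i)"

definition Gamma_in :: "'e ordered_digraph \<Rightarrow> nat \<Rightarrow> nat \<Rightarrow> nat" where
  "Gamma_in D v i = tail (base D) (in_edge D v i)"

datatype var = Var_n | Var_m | Var_v0 | Var_c | Var_u | Var_v | Var_i | Var_j

datatype arr = Arr_next | Arr_visited | Arr_skipped | Arr_B

datatype aexp =
    Const nat
  | Var var
  | Elem arr aexp
  | Plus aexp aexp
  | Minus aexp aexp
  | OutDeg aexp
  | InDeg aexp
  | OutHead aexp aexp
  | InTail aexp aexp

datatype bexp =
    Eq aexp aexp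
  | Le aexp aexp
  | Not bexp
  | And bexp bexp

datatype com =
    Skip
  | Assign var aexp
  | AssignElem arr aexp aexp
  | Write aexp aexp
  | Seq com com
  | If bexp com com
  | While bexp com

record state =
  scalar :: "var \<Rightarrow> nat"
  array :: "arr \<Rightarrow> nat \<Rightarrow> nat"
  written :: "(nat \<times> nat) list"

text \<open>The primitive operations of the machine, tagged with the integers they act on. A memory
  access to an array carries the index and the value that is transferred.\<close>

datatype operation =
    Op_load nat
  | Op_store nat
  | Op_load_elem nat nat
  | Op_store_elem nat nat
  | Op_add nat nat
  | Op_sub nat nat
  | Op_compare nat nat
  | Op_branch
  | Op_write nat nat
  | Op_out_degree nat
  | Op_in_degree nat
  | Op_out_head nat nat
  | Op_in_tail nat nat

text \<open>Evaluation returns the value together with the list of operations carried out. It is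
  undefined (\<open>None\<close>) if an array is accessed outside \<open>{1..n}\<close> or the graph is queried for a vertex
  or an edge that does not exist. Subtraction truncates at \<open>0\<close>.\<close>

fun aval :: "'e ordered_digraph \<Rightarrow> state \<Rightarrow> aexp \<Rightarrow> (nat \<times> operation list) option" where
  "aval D s (Const k) = Some (k, [Op_load k])"
| "aval D s (Var x) = Some (scalar s x, [Op_load (scalar s x)])"
| "aval D s (Elem a e) = do {
     (i, p) \<leftarrow> aval D s e;
     if i \<in> {1..num_verts D}
     then Some (array s a i, p @ [Op_load_elem i (array s a i)])
     else None }"
| "aval D s (Plus e f) = do {
     (x, p) \<leftarrow> aval D s e;
     (y, q) \<leftarrow> aval D s f;
     Some (x + y, p @ q @ [Op_add x y]) }"
| "aval D s (Minus e f) = do {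
     (x, p) \<leftarrow> aval D s e;
     (y, q) \<leftarrow> aval D s f;
     Some (x - y, p @ q @ [Op_sub x y]) }"
| "aval D s (OutDeg e) = do {
     (v, p) \<leftarrow> aval D s e;
     if v \<in> verts (base D)
     then Some (out_degree (base D) v, p @ [Op_out_degree v])
     else None }"
| "aval D s (InDeg e) = do {
     (v, p) \<leftarrow> aval D s e;
     if v \<in> verts (base D)
     then Some (in_degree (base D) v, p @ [Op_in_degree v])
     else None }"
| "aval D s (OutHead e f) = do {
     (v, p) \<leftarrow> aval D s e;
     (i, q) \<leftarrow> aval D s f;
     if v \<in> verts (base D) \<and> i \<in> {1..out_degree (base D) v}
     then Some (Gamma_out D v i, p @ q @ [Op_out_head v i])
     else None }"
| "aval D s (InTail e f) = do {
     (v, p) \<leftarrow> aval D s e;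
     (i, q) \<leftarrow> aval D s f;
     if v \<in> verts (base D) \<and> i \<in> {1..in_degree (base D) v}
     then Some (Gamma_in D v i, p @ q @ [Op_in_tail v i])
     else None }"

text \<open>Conjunction does not evaluate its second argument if the first one is false.\<close>

fun bval :: "'e ordered_digraph \<Rightarrow> state \<Rightarrow> bexp \<Rightarrow> (bool \<times> operation list) option" where
  "bval D s (Eq e f) = do {
     (x, p) \<leftarrow> aval D s e;
     (y, q) \<leftarrow> aval D s f;
     Some (x = y, p @ q @ [Op_compare x y]) }"
| "bval D s (Le e f) = do {
     (x, p) \<leftarrow> aval D s e;
     (y, q) \<leftarrow> aval D s f;
     Some (x \<le> y, p @ q @ [Op_compare x y]) }"
| "bval D s (Not b) = do {
     (r, p) \<leftarrow> bval D s b;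
     Some (\<not> r, p @ [Op_branch]) }"
| "bval D s (And b c) = do {
     (r, p) \<leftarrow> bval D s b;
     if r
     then do { (r', q) \<leftarrow> bval D s c; Some (r', p @ [Op_branch] @ q) }
     else Some (False, p @ [Op_branch]) }"

text \<open>\<open>exec D c s p s'\<close>: started in \<open>s\<close>, the program \<open>c\<close> terminates in \<open>s'\<close>, without any undefined
  access, and carries out the sequence \<open>p\<close> of primitive operations.\<close>

inductive exec ::
  "'e ordered_digraph \<Rightarrow> com \<Rightarrow> state \<Rightarrow> operation list \<Rightarrow> state \<Rightarrow> bool" for D where
  exec_Skip: "exec D Skip s [] s"
| exec_Assign:
    "aval D s e = Some (x, p) \<Longrightarrow>
     exec D (Assign a e) s (p @ [Op_store x]) (s\<lparr>scalar := (scalar s)(a := x)\<rparr>)"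
| exec_AssignElem:
    "aval D s e = Some (i, p) \<Longrightarrow> aval D s f = Some (x, q) \<Longrightarrow> i \<in> {1..num_verts D} \<Longrightarrow>
     exec D (AssignElem a e f) s (p @ q @ [Op_store_elem i x])
       (s\<lparr>array := (array s)(a := (array s a)(i := x))\<rparr>)"
| exec_Write:
    "aval D s e = Some (x, p) \<Longrightarrow> aval D s f = Some (y, q) \<Longrightarrow>
     exec D (Write e f) s (p @ q @ [Op_write x y]) (s\<lparr>written := written s @ [(x, y)]\<rparr>)"
| exec_Seq:
    "exec D c1 s1 p s2 \<Longrightarrow> exec D c2 s2 q s3 \<Longrightarrow> exec D (Seq c1 c2) s1 (p @ q) s3"
| exec_If_True:
    "bval D s b = Some (True, p) \<Longrightarrow> exec D c1 s q s' \<Longrightarrow>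
     exec D (If b c1 c2) s (p @ [Op_branch] @ q) s'"
| exec_If_False:
    "bval D s b = Some (False, p) \<Longrightarrow> exec D c2 s q s' \<Longrightarrow>
     exec D (If b c1 c2) s (p @ [Op_branch] @ q) s'"
| exec_While_False:
    "bval D s b = Some (False, p) \<Longrightarrow> exec D (While b c) s (p @ [Op_branch]) s"
| exec_While_True:
    "bval D s1 b = Some (True, p) \<Longrightarrow> exec D c s1 q s2 \<Longrightarrow> exec D (While b c) s2 r s3 \<Longrightarrow>
     exec D (While b c) s1 (p @ [Op_branch] @ q @ r) s3"

inductive_cases exec_SkipE: "exec D Skip s p s'"
inductive_cases exec_AssignE: "exec D (Assign a e) s p s'"
inductive_cases exec_AssignElemE: "exec D (AssignElem a e f) s p s'"
inductive_cases exec_WriteE: "exec D (Write e f) s p s'"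
inductive_cases exec_SeqE: "exec D (Seq c1 c2) s p s'"
inductive_cases exec_IfE: "exec D (If b c1 c2) s p s'"
inductive_cases exec_WhileE: "exec D (While b c) s p s'"

text \<open>The language is deterministic, so the existence of a terminating execution means that the
  execution terminates.\<close>

lemma exec_deterministic:
  "exec D c s p s' \<Longrightarrow> exec D c s q s'' \<Longrightarrow> q = p \<and> s'' = s'"
proof (induction arbitrary: q s'' rule: exec.induct)
  case (exec_Skip s)
  then show ?case by (rule exec_SkipE) simp
next
  case (exec_Assign s e x p a)
  from exec_Assign.prems exec_Assign.hyps show ?case by (elim exec_AssignE) simp
next
  case (exec_AssignElem s e i p f x q' a)
  from exec_AssignElem.prems exec_AssignElem.hyps show ?case by (elim exec_AssignElemE) simp
next
  case (exec_Write s e x p f y q')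
  from exec_Write.prems exec_Write.hyps show ?case by (elim exec_WriteE) simp
next
  case (exec_Seq c1 s1 p s2 c2 q' s3)
  from exec_Seq.prems obtain pa pb t where
    "q = pa @ pb" "exec D c1 s1 pa t" "exec D c2 t pb s''" by (rule exec_SeqE)
  moreover from this have "pa = p \<and> t = s2" using exec_Seq.IH(1) by blast
  moreover from calculation have "pb = q' \<and> s'' = s3" using exec_Seq.IH(2) by blast
  ultimately show ?case by simp
next
  case (exec_If_True s b p c1 q' s' c2)
  from exec_If_True.prems show ?case
  proof (rule exec_IfE)
    fix pa qa
    assume "q = pa @ Op_branch # qa" "bval D s b = Some (True, pa)"
      and c: "exec D c1 s qa s''"
    moreover have "qa = q' \<and> s'' = s'" by (rule exec_If_True.IH[OF c])
    ultimately show ?thesis using exec_If_True.hyps by simp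
  qed (use exec_If_True.hyps in simp_all)
next
  case (exec_If_False s b p c2 q' s' c1)
  from exec_If_False.prems show ?case
  proof (rule exec_IfE)
    fix pa qa
    assume "q = pa @ Op_branch # qa" "bval D s b = Some (False, pa)"
      and c: "exec D c2 s qa s''"
    moreover have "qa = q' \<and> s'' = s'" by (rule exec_If_False.IH[OF c])
    ultimately show ?thesis using exec_If_False.hyps by simp
  qed (use exec_If_False.hyps in simp_all)
next
  case (exec_While_False s b p c)
  from exec_While_False.prems show ?case
    by (rule exec_WhileE) (use exec_While_False.hyps in simp_all)
next
  case (exec_While_True s1 b p c q' s2 r s3)
  from exec_While_True.prems show ?case
  proof (rule exec_WhileE)
    fix pa qa t ra
    assume "q = pa @ Op_branch # qa @ ra" "bval D s1 b = Some (True, pa)"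
      and c: "exec D c s1 qa t" and w: "exec D (While b c) t ra s''"
    moreover have "qa = q' \<and> t = s2" by (rule exec_While_True.IH(1)[OF c])
    moreover from this w have "ra = r \<and> s'' = s3" using exec_While_True.IH(2) by blast
    ultimately show ?thesis using exec_While_True.hyps by simp
  qed (use exec_While_True.hyps in simp_all)
qed

fun seqs :: "com list \<Rightarrow> com" where
  "seqs [] = Skip"
| "seqs [c] = c"
| "seqs (c # cs) = Seq c (seqs cs)"

abbreviation (input) Lt :: "aexp \<Rightarrow> aexp \<Rightarrow> bexp" where
  "Lt e f \<equiv> Not (Le f e)"

definition initialise :: com where
  "initialise = seqs [
     Assign Var_j (Const 1),
     While (Le (Var Var_j) (Var Var_n)) (seqs [
       AssignElem Arr_next (Var Var_j) (Const 0),
       AssignElem Arr_visited (Var Var_j) (Const 0),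
       AssignElem Arr_skipped (Var Var_j) (Const 0),
       AssignElem Arr_B (Var Var_j) (Const 0),
       Assign Var_j (Plus (Var Var_j) (Const 1))]),
     Assign Var_c (Const 0),
     Assign Var_u (Var Var_v0),
     AssignElem Arr_visited (Var Var_u) (Const 1)]"

definition backward_step :: com where
  "backward_step = seqs [
     Assign Var_v (InTail (Var Var_u) (Var Var_i)),
     If (Eq (Elem Arr_visited (Var Var_v)) (Const 0))
       (seqs [
         If (Not (Eq (Var Var_v) (Var Var_v0)))
           (AssignElem Arr_B (Var Var_v) (Var Var_u))
           Skip,
         AssignElem Arr_visited (Var Var_v) (Const 1)])
       Skip,
     Assign Var_u (Var Var_v)]"

definition forward_step :: com where
  "forward_step = seqs [
     Assign Var_i (Minus (Elem Arr_next (Var Var_u)) (InDeg (Var Var_u))),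
     If (And (Le (Var Var_i) (OutDeg (Var Var_u)))
          (And (Eq (OutHead (Var Var_u) (Var Var_i)) (Elem Arr_B (Var Var_u)))
               (Eq (Elem Arr_skipped (Var Var_u)) (Const 0))))
       (seqs [
         AssignElem Arr_skipped (Var Var_u) (Const 1),
         AssignElem Arr_next (Var Var_u) (Plus (Elem Arr_next (Var Var_u)) (Const 1)),
         Assign Var_i (Plus (Var Var_i) (Const 1))])
       Skip,
     If (Lt (OutDeg (Var Var_u)) (Var Var_i))
       (Assign Var_v (Elem Arr_B (Var Var_u)))
       (Assign Var_v (OutHead (Var Var_u) (Var Var_i))),
     Write (Var Var_u) (Var Var_v),
     Assign Var_c (Plus (Var Var_c) (Const 1)),
     Assign Var_u (Var Var_v)]"

definition space_efficient_hierholzer :: com where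
  "space_efficient_hierholzer = seqs [
     initialise,
     While (Lt (Var Var_c) (Var Var_m)) (seqs [
       AssignElem Arr_next (Var Var_u) (Plus (Elem Arr_next (Var Var_u)) (Const 1)),
       Assign Var_i (Elem Arr_next (Var Var_u)),
       If (Le (Var Var_i) (InDeg (Var Var_u))) backward_step forward_step])]"

text \<open>The input consists of \<open>n\<close>, \<open>m\<close> and the chosen start vertex; the other variables and the
  arrays have arbitrary initial contents.\<close>

definition initial_state :: "'e ordered_digraph \<Rightarrow> nat \<Rightarrow> state \<Rightarrow> bool" where
  "initial_state D v0 s \<longleftrightarrow>
     scalar s Var_n = num_verts D \<and> scalar s Var_m = num_arcs D \<and> scalar s Var_v0 = v0 \<and>
     written s = []"

text \<open>The integers that occur in an arithmetic or memory operation, including its result;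
  \<open>None\<close> marks the operations that access the graph.\<close>

fun op_integers :: "operation \<Rightarrow> nat set option" where
  "op_integers (Op_load x) = Some {x}"
| "op_integers (Op_store x) = Some {x}"
| "op_integers (Op_load_elem i x) = Some {i, x}"
| "op_integers (Op_store_elem i x) = Some {i, x}"
| "op_integers (Op_add x y) = Some {x, y, x + y}"
| "op_integers (Op_sub x y) = Some {x, y}"
| "op_integers (Op_compare x y) = Some {x, y}"
| "op_integers Op_branch = Some {}"
| "op_integers (Op_write x y) = Some {x, y}"
| "op_integers (Op_out_degree v) = None"
| "op_integers (Op_in_degree v) = None"
| "op_integers (Op_out_head v i) = None"
| "op_integers (Op_in_tail v i) = None"

text \<open>The word length is \<open>\<lceil>lg m\<rceil>\<close>, but at least one bit.\<close>

definition word_length :: "'e ordered_digraph \<Rightarrow> nat" where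
  "word_length D = max 1 (nat \<lceil>log 2 (real (num_arcs D))\<rceil>)"

text \<open>The algorithm handles integers slightly larger than one word: \<open>c\<close> reaches \<open>m\<close>, and an entry
  of \<open>next\<close> can reach \<open>2 * m\<close>. The assumption is therefore stated for integers of any fixed number
  \<open>k\<close> of words, where the bound may depend on \<open>k\<close> but not on the graph.\<close>

definition constant_time_arithmetic :: "('e ordered_digraph \<Rightarrow> operation \<Rightarrow> nat) \<Rightarrow> bool" where
  "constant_time_arithmetic cost \<longleftrightarrow>
     (\<forall>k. \<exists>K. \<forall>D op X. ordered_eulerian D \<longrightarrow> op_integers op = Some X \<longrightarrow>
        (\<forall>x \<in> X. x < 2 ^ (k * word_length D)) \<longrightarrow> cost D op \<le> K)"

definition constant_time_graph_access :: "('e ordered_digraph \<Rightarrow> operation \<Rightarrow> nat) \<Rightarrow> bool" where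
  "constant_time_graph_access cost \<longleftrightarrow>
     (\<exists>K. \<forall>D. ordered_eulerian D \<longrightarrow> (\<forall>v \<in> verts (base D).
        cost D (Op_out_degree v) \<le> K \<and>
        cost D (Op_in_degree v) \<le> K \<and>
        (\<forall>i \<in> {1..out_degree (base D) v}. cost D (Op_out_head v i) \<le> K) \<and>
        (\<forall>i \<in> {1..in_degree (base D) v}. cost D (Op_in_tail v i) \<le> K)))"

definition running_time ::
  "('e ordered_digraph \<Rightarrow> operation \<Rightarrow> nat) \<Rightarrow> 'e ordered_digraph \<Rightarrow> operation list \<Rightarrow> nat" where
  "running_time cost D p = (\<Sum>op \<leftarrow> p. cost D op)"

end

theory Submission
  imports Defs
begin

text \<open>The walk never repeats an edge in the forward direction, nor one in the backward direction.
  A forward step at \<open>u\<close> occurs only when all in-edges of \<open>u\<close> have been traversed backwards; by the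
  degree balance, the current backward trail is then closed, so that all out-edges of \<open>u\<close> have been
  traversed backwards, too, and the next vertex is already visited. The forward steps form a trail,
  which can only get stuck at \<open>v\<^sub>0\<close>. If it does, then \<open>v\<^sub>0\<close> is exhausted, and exhaustion spreads to
  all vertices, because every other vertex \<open>x\<close> leaves through its edge to \<open>B x\<close> last. So the loop
  makes at most \<open>2 * m\<close> iterations before all edges have been written.\<close>

section \<open>The two interleaved trails\<close>

locale ordered_eulerian_digraph =
  fixes D :: "'e ordered_digraph"
  assumes ordered_eulerian: "ordered_eulerian D"
begin

abbreviation "V \<equiv> verts (base D)"
abbreviation "E \<equiv> arcs (base D)"
abbreviation "indeg \<equiv> in_degree (base D)"
abbreviation "outdeg \<equiv> out_degree (base D)"
abbreviation "ins \<equiv> in_arcs (base D)"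
abbreviation "outs \<equiv> out_arcs (base D)"

sublocale fin_digraph "base D"
  using ordered_eulerian by (simp add: ordered_eulerian_def eulerian_def)

lemma strongly_connected: "strongly_connected (base D)"
  and outdeg_eq_indeg: "x \<in> V \<Longrightarrow> outdeg x = indeg x"
  and verts_eq: "V = {1..num_verts D}"
  and bij_out_edge: "x \<in> V \<Longrightarrow> bij_betw (out_edge D x) {1..outdeg x} (outs x)"
  and bij_in_edge: "x \<in> V \<Longrightarrow> bij_betw (in_edge D x) {1..indeg x} (ins x)"
  using ordered_eulerian unfolding ordered_eulerian_def eulerian_def by blast+

lemma zero_notin_verts: "0 \<notin> V"
  by (subst verts_eq) simp

lemma vert_in_range: "x \<in> V \<Longrightarrow> x \<in> {1..num_verts D}"
  by (subst (asm) verts_eq)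

lemma vert_le_num_verts: "x \<in> V \<Longrightarrow> x \<le> num_verts D"
  by (subst (asm) verts_eq) simp

lemma out_edge_in_outs: "x \<in> V \<Longrightarrow> i \<in> {1..outdeg x} \<Longrightarrow> out_edge D x i \<in> outs x"
  using bij_out_edge bij_betwE by blast

lemma in_edge_in_ins: "x \<in> V \<Longrightarrow> i \<in> {1..indeg x} \<Longrightarrow> in_edge D x i \<in> ins x"
  using bij_in_edge bij_betwE by blast

lemma out_edge_eq_iff:
  "x \<in> V \<Longrightarrow> i \<in> {1..outdeg x} \<Longrightarrow> j \<in> {1..outdeg x} \<Longrightarrow> out_edge D x i = out_edge D x j \<longleftrightarrow> i = j"
  by (meson bij_out_edge bij_betw_def inj_on_eq_iff)

lemma in_edge_eq_iff:
  "x \<in> V \<Longrightarrow> i \<in> {1..indeg x} \<Longrightarrow> j \<in> {1..indeg x} \<Longrightarrow> in_edge D x i = in_edge D x j \<longleftrightarrow> i = j"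
  by (meson bij_in_edge bij_betw_def inj_on_eq_iff)

lemma outs_eq_image: "x \<in> V \<Longrightarrow> outs x = out_edge D x ` {1..outdeg x}"
  using bij_out_edge by (simp add: bij_betw_def)

lemma ins_eq_image: "x \<in> V \<Longrightarrow> ins x = in_edge D x ` {1..indeg x}"
  using bij_in_edge by (simp add: bij_betw_def)

lemma outdeg_le_num_arcs: "outdeg x \<le> num_arcs D"
  unfolding out_degree_def by (intro card_mono) auto

lemma indeg_le_num_arcs: "indeg x \<le> num_arcs D"
  unfolding in_degree_def by (intro card_mono) auto

text \<open>With two vertices or more, strong connectivity gives every vertex an out-edge, so
  \<open>tail\<close> maps the edges onto the vertices. The \<open>max\<close> covers a single
  vertex without edges.\<close>

lemma num_verts_le: "num_verts D \<le> max 1 (num_arcs D)"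
proof (cases "num_verts D \<le> 1")
  case False
  have "V \<subseteq> tail (base D) ` E"
  proof
    fix x assume x: "x \<in> V"
    obtain y where y: "y \<in> V" "y \<noteq> x"
      using False x by (metis card_le_Suc0_iff_eq finite_verts One_nat_def)
    have "x \<rightarrow>\<^sup>*\<^bsub>base D\<^esub> y"
      using strongly_connected x y by (auto simp: strongly_connected_def)
    then show "x \<in> tail (base D) ` E"
      using y by (cases rule: converse_reachable_cases) (auto simp: arcs_ends_conv)
  qed
  then have "num_verts D \<le> num_arcs D"
    by (meson card_image_le card_mono finite_arcs finite_imageI order_trans)
  then show ?thesis by simp
qed simp

lemma num_verts_le_linear: "num_verts D \<le> 2 * num_arcs D + 1"
  using num_verts_le by (simp add: max_def split: if_splits)

end

text \<open>The set \<open>R\<close> collects the edges traversed backwards and \<open>F\<close> the edges written. They form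
  trails from \<open>b\<close> to \<open>u\<close> in the reversed graph and from \<open>v\<^sub>0\<close> to \<open>b\<close> in the graph, up to closed
  trails; only the resulting degree conditions are recorded. In \<open>written_out\<close>, the second disjunct
  describes the out-edges written at \<open>x\<close> once the edge \<open>k\<close> to \<open>B x\<close> has been skipped: it is
  written after all others, when \<open>nx x - indeg x\<close> exceeds the out-degree.\<close>

locale tour = ordered_eulerian_digraph D for D :: "'e ordered_digraph" +
  fixes v\<^sub>0 :: nat and nx vis sk B :: "nat \<Rightarrow> nat" and u b :: nat and R F :: "'e set"
  assumes v0_vert: "v\<^sub>0 \<in> V" and u_vert: "u \<in> V" and b_vert: "b \<in> V"
    and R_arcs: "R \<subseteq> E" and F_arcs: "F \<subseteq> E"
    and R_ins: "x \<in> V \<Longrightarrow> ins x \<inter> R = in_edge D x ` {1..min (nx x) (indeg x)}"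
    and written_out: "x \<in> V \<Longrightarrow>
      sk x = 0 \<and> nx x - indeg x \<le> outdeg x \<and>
        (\<forall>i \<in> {1..nx x - indeg x}. Gamma_out D x i \<noteq> B x) \<and>
        outs x \<inter> F = out_edge D x ` {1..nx x - indeg x} \<or>
      sk x = 1 \<and> nx x - indeg x \<le> outdeg x + 1 \<and>
        (\<exists>k \<in> {1..outdeg x}. k < nx x - indeg x \<and> Gamma_out D x k = B x \<and>
          outs x \<inter> F = out_edge D x `
            (if nx x - indeg x \<le> outdeg x then {1..nx x - indeg x} - {k} else {1..outdeg x}))"
    and R_balance: "x \<in> V \<Longrightarrow>
      card (ins x \<inter> R) + of_bool (x = u) = card (outs x \<inter> R) + of_bool (x = b)"
    and F_balance: "x \<in> V \<Longrightarrow>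
      card (outs x \<inter> F) + of_bool (x = b) = card (ins x \<inter> F) + of_bool (x = v\<^sub>0)"
    and unvisited: "x \<in> V \<Longrightarrow> vis x = 0 \<Longrightarrow> nx x = 0"
    and vis_le: "x \<in> V \<Longrightarrow> vis x \<le> 1"
    and v0_visited: "vis v\<^sub>0 \<noteq> 0" and u_visited: "vis u \<noteq> 0"
    and R_tail: "e \<in> R \<Longrightarrow> vis (tail (base D) e) \<noteq> 0"
    and B_v0: "B v\<^sub>0 = 0"
    and B_arc: "x \<in> V \<Longrightarrow> vis x \<noteq> 0 \<Longrightarrow> x \<noteq> v\<^sub>0 \<Longrightarrow> \<exists>e \<in> outs x. head (base D) e = B x"
    and B_chain: "x \<in> V \<Longrightarrow> vis x \<noteq> 0 \<Longrightarrow>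
      (x, v\<^sub>0) \<in> {(y, B y) | y. y \<in> V \<and> vis y \<noteq> 0 \<and> y \<noteq> v\<^sub>0}\<^sup>*"
begin

section \<open>Consequences of the invariant\<close>

lemma written_out_cases:
  assumes "x \<in> V"
  obtains
      (unskipped) "sk x = 0" "nx x - indeg x \<le> outdeg x"
        "\<forall>i \<in> {1..nx x - indeg x}. Gamma_out D x i \<noteq> B x"
        "outs x \<inter> F = out_edge D x ` {1..nx x - indeg x}"
    | (skipped) k where "sk x = 1" "nx x - indeg x \<le> outdeg x + 1" "k \<in> {1..outdeg x}"
        "k < nx x - indeg x" "Gamma_out D x k = B x"
        "outs x \<inter> F = out_edge D x `
          (if nx x - indeg x \<le> outdeg x then {1..nx x - indeg x} - {k} else {1..outdeg x})"
  using written_out[OF assms]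
proof (elim disjE conjE bexE)
qed (rule unskipped skipped; assumption)+

lemma sk_le: "x \<in> V \<Longrightarrow> sk x \<le> 1"
  using written_out[of x] by auto

lemma B_vert: "x \<in> V \<Longrightarrow> vis x \<noteq> 0 \<Longrightarrow> x \<noteq> v\<^sub>0 \<Longrightarrow> B x \<in> V"
  using B_arc[of x] head_in_verts in_out_arcs_conv by metis

lemma B_le: "x \<in> V \<Longrightarrow> vis x \<noteq> 0 \<Longrightarrow> B x \<le> num_verts D"
  using B_vert[of x] B_v0 vert_le_num_verts by (cases "x = v\<^sub>0") auto

text \<open>An in-edge of \<open>x\<close> lies in \<open>R\<close> only if \<open>nx x\<close> has
  left 0, which requires \<open>x\<close> to be visited. A forward step uses an edge of
  \<open>R\<close>, so it never meets an unvisited vertex.\<close>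

lemma R_head: "e \<in> R \<Longrightarrow> vis (head (base D) e) \<noteq> 0"
proof
  assume e: "e \<in> R" and 0: "vis (head (base D) e) = 0"
  then have *: "e \<in> ins (head (base D) e) \<inter> R" and h: "head (base D) e \<in> V" using R_arcs by auto
  from unvisited[OF h 0] R_ins[OF h] * show False by simp
qed

text \<open>All parallel edges \<open>x \<rightarrow> B x\<close> have been written if \<open>B x\<close> is exhausted, including the one that
  is scheduled last at \<open>x\<close>.\<close>

lemma exhausted_step:
  assumes x: "x \<in> V" "vis x \<noteq> 0" "x \<noteq> v\<^sub>0" and fin: "ins (B x) \<subseteq> F"
  shows "outs x \<subseteq> F"
proof -
  have last: "out_edge D x i \<in> F" if "i \<in> {1..outdeg x}" "Gamma_out D x i = B x" for i
    using fin out_edge_in_outs[OF x(1) that(1)] that(2) by (auto simp: Gamma_out_def)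
  from x(1) show ?thesis
  proof (cases rule: written_out_cases)
    case unskipped
    \<comment> \<open>This case is contradictory: an edge to \<open>B x\<close> exists and is
      written by \<open>last\<close>, but the written out-edges are those up to the pointer, and
      none of them leads to \<open>B x\<close>.\<close>
    obtain e where e: "e \<in> outs x" "head (base D) e = B x" using B_arc x by blast
    then obtain i where i: "i \<in> {1..outdeg x}" "e = out_edge D x i"
      using outs_eq_image[OF x(1)] by blast
    then have "out_edge D x i \<in> outs x \<inter> F" using last e by (auto simp: Gamma_out_def)
    then obtain j where j: "j \<in> {1..nx x - indeg x}" "out_edge D x i = out_edge D x j"
      using unskipped(4) by auto
    then have "i = j" using out_edge_eq_iff[OF x(1) i(1), of j] unskipped(2) by auto
    then show ?thesis using unskipped(3) j(1) e i by (auto simp: Gamma_out_def)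
  next
    case (skipped k)
    \<comment> \<open>While the pointer is in range, the skipped edge \<open>k\<close> is unwritten,
      although it enters \<open>B x\<close>.\<close>
    have "\<not> nx x - indeg x \<le> outdeg x"
    proof
      assume le: "nx x - indeg x \<le> outdeg x"
      have "out_edge D x k \<in> outs x \<inter> F" using last skipped out_edge_in_outs x(1) by blast
      then have "out_edge D x k \<in> out_edge D x ` ({1..nx x - indeg x} - {k})"
        using skipped(6) le by simp
      then obtain j where j: "j \<in> {1..nx x - indeg x} - {k}" "out_edge D x k = out_edge D x j"
        by blast
      then show False using out_edge_eq_iff[OF x(1) skipped(3), of j] le by auto
    qed
    then show ?thesis using skipped(6) outs_eq_image[OF x(1)] by auto
  qed
qed

text \<open>A trail stuck at its end \<open>b\<close> is closed, so at each vertex as many in-edges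
  as out-edges are written. Exhaustion then spreads from \<open>b\<close> against the pointers
  \<open>B\<close> to all visited vertices, and strong connectivity shows that every vertex is
  visited.\<close>

lemma all_written:
  assumes out: "outs b \<subseteq> F"
  shows "F = E"
proof -
  have "card (ins b \<inter> F) \<le> indeg b"
    unfolding in_degree_def by (intro card_mono) auto
  moreover have "outs b \<inter> F = outs b" using out by auto
  \<comment> \<open>Otherwise the balance at \<open>b\<close> would require
    \<open>outdeg b + 1\<close> written in-edges, more than \<open>b\<close> has.\<close>
  ultimately have bv0: "b = v\<^sub>0"
    using F_balance[OF b_vert] outdeg_eq_indeg[OF b_vert]
    by (cases "b = v\<^sub>0") (auto simp: out_degree_def)
  have ins_F: "ins x \<subseteq> F" if x: "x \<in> V" "outs x \<subseteq> F" for x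
  proof -
    have "outs x \<inter> F = outs x" using x by auto
    then have "card (ins x \<inter> F) = card (ins x)"
      using F_balance[OF x(1)] outdeg_eq_indeg[OF x(1)] bv0
      by (auto simp: out_degree_def in_degree_def)
    then have "ins x \<inter> F = ins x" by (intro card_subset_eq) auto
    then show ?thesis by auto
  qed
  \<comment> \<open>Along the chain of pointers, exhaustion passes from \<open>B y\<close> to
    \<open>y\<close>: the in-edges of \<open>B y\<close> are all written, so
    \<open>exhausted_step\<close> applies.\<close>
  have finished: "outs x \<subseteq> F" if x: "x \<in> V" "vis x \<noteq> 0" for x
    using B_chain[OF x]
  proof (induction rule: converse_rtrancl_induct)
    case base
    then show ?case using out bv0 by simp
  next
    case (step y z)
    then have y: "y \<in> V" "vis y \<noteq> 0" "y \<noteq> v\<^sub>0" "z = B y" by auto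
    then have "B y \<in> V" using B_vert by blast
    then show ?case using exhausted_step[OF y(1-3)] ins_F step.IH y(4) by simp
  qed
  have tails: "vis (tail (base D) e) \<noteq> 0" if x: "x \<in> V" "vis x \<noteq> 0" and e: "e \<in> ins x" for x e
  proof -
    \<comment> \<open>By degree balance \<open>x\<close> has an out-edge, and it is written. So the
      pointer of \<open>x\<close> has passed all in-edges, which puts them into \<open>R\<close>,
      and \<open>R_tail\<close> applies.\<close>
    have "indeg x \<noteq> 0" using e finite_in_arcs by (auto simp: in_degree_def)
    then have "outs x \<noteq> {}" using outdeg_eq_indeg[OF x(1)] by (auto simp: out_degree_def)
    moreover have "outs x \<inter> F = outs x" using finished[OF x] by auto
    ultimately have "nx x - indeg x \<noteq> 0" using written_out[OF x(1)] by auto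
    then have "ins x \<inter> R = ins x" using R_ins[OF x(1)] ins_eq_image[OF x(1)] by simp
    then show ?thesis using e R_tail by blast
  qed
  \<comment> \<open>Being visited spreads backwards along any path to
    \<open>v\<^sub>0\<close>.\<close>
  have "vis x \<noteq> 0" if x: "x \<in> V" for x
  proof -
    have "x \<rightarrow>\<^sup>*\<^bsub>base D\<^esub> v\<^sub>0" using strongly_connected x v0_vert by (auto simp: strongly_connected_def)
    then show ?thesis
    proof (induction rule: converse_reachable_induct)
      case base
      show ?case by (rule v0_visited)
    next
      case (step x y)
      then obtain e where e: "e \<in> E" "tail (base D) e = x" "head (base D) e = y"
        by (auto simp: arcs_ends_conv)
      then show ?case using tails[of y e] step.IH by auto
    qed
  qed
  then have "e \<in> F" if "e \<in> E" for e
    using finished[of "tail (base D) e"] that by auto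
  then show ?thesis using F_arcs by blast
qed

text \<open>All \<open>indeg u\<close> in-edges of \<open>u\<close> lie in \<open>R\<close>, so the
  balance at \<open>u\<close> has \<open>indeg u + 1\<close> on the left. At most
  \<open>outdeg u = indeg u\<close> edges of \<open>R\<close> leave \<open>u\<close>, which forces
  the indicator of \<open>u = b\<close> to be 1 and all out-edges to be in \<open>R\<close>.\<close>

lemma forward_start:
  assumes ge: "indeg u \<le> nx u"
  shows "b = u" "outs u \<subseteq> R"
proof -
  have "ins u \<inter> R = ins u" using R_ins[OF u_vert] ins_eq_image[OF u_vert] ge by (simp add: min_def)
  moreover have le: "card (outs u \<inter> R) \<le> outdeg u"
    unfolding out_degree_def by (intro card_mono) auto
  ultimately have eq: "indeg u + 1 = card (outs u \<inter> R) + of_bool (u = b)"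
    using R_balance[OF u_vert] by (simp add: in_degree_def)
  then show "b = u" using le outdeg_eq_indeg[OF u_vert] by (cases "u = b") auto
  then have "card (outs u \<inter> R) = card (outs u)"
    using eq outdeg_eq_indeg[OF u_vert] by (simp add: out_degree_def)
  then have "outs u \<inter> R = outs u" by (intro card_subset_eq) auto
  then show "outs u \<subseteq> R" by auto
qed

section \<open>Preservation of the invariant by backward and forward steps\<close>

lemma backward_tour:
  assumes i: "Suc (nx u) \<le> indeg u"
  defines "e \<equiv> in_edge D u (Suc (nx u))"
  defines "v \<equiv> tail (base D) e"
  shows "e \<notin> R" "e \<in> E"
    "tour D v\<^sub>0 (nx(u := Suc (nx u))) (vis(v := 1)) sk
       (if vis v = 0 then B(v := u) else B) v b (insert e R) F"
proof -
  have e: "e \<in> ins u" unfolding e_def using in_edge_in_ins[OF u_vert] i by auto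
  then show eE: "e \<in> E" by auto
  have hd: "head (base D) e = u" using e by auto
  have vV: "v \<in> V" using eE by (simp add: v_def)
  show eR: "e \<notin> R"
  proof
    assume "e \<in> R"
    then have "e \<in> in_edge D u ` {1..min (nx u) (indeg u)}" using R_ins[OF u_vert] e by auto
    then obtain j where j: "j \<in> {1..min (nx u) (indeg u)}" "in_edge D u (Suc (nx u)) = in_edge D u j"
      by (auto simp: e_def)
    then have "Suc (nx u) = j" by (subst (asm) in_edge_eq_iff[OF u_vert]) (use i in auto)
    then show False using j by auto
  qed
  have finR: "finite R" by (rule finite_subset[OF R_arcs finite_arcs])
  let ?nx = "nx(u := Suc (nx u))" and ?vis = "vis(v := 1)" and ?R = "insert e R"
  let ?B = "if vis v = 0 then B(v := u) else B"
  have B_eq: "?B x = B x" if "vis x \<noteq> 0" for x using that by auto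
  have uv: "vis v = 0 \<Longrightarrow> v \<noteq> u" using u_visited by auto
  \<comment> \<open>Hence the update of \<open>B\<close> can be stated without the test against
    \<open>v\<^sub>0\<close> that the program makes.\<close>
  have v0v: "vis v = 0 \<Longrightarrow> v \<noteq> v\<^sub>0" using v0_visited by auto
  show "tour D v\<^sub>0 ?nx ?vis sk ?B v b ?R F"
  proof unfold_locales
    fix x assume x: "x \<in> V"
    show "ins x \<inter> ?R = in_edge D x ` {1..min (?nx x) (indeg x)}"
    proof (cases "x = u")
      case True
      have "{1..Suc (nx u)} = insert (Suc (nx u)) {1..nx u}" by auto
      then show ?thesis using R_ins[OF u_vert] True e i by (simp add: e_def min_def)
    next
      case False
      then show ?thesis using R_ins[OF x] hd by simp
    qed
    show "sk x = 0 \<and> ?nx x - indeg x \<le> outdeg x \<and>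
        (\<forall>i \<in> {1..?nx x - indeg x}. Gamma_out D x i \<noteq> ?B x) \<and>
        outs x \<inter> F = out_edge D x ` {1..?nx x - indeg x} \<or>
      sk x = 1 \<and> ?nx x - indeg x \<le> outdeg x + 1 \<and>
        (\<exists>k \<in> {1..outdeg x}. k < ?nx x - indeg x \<and> Gamma_out D x k = ?B x \<and>
          outs x \<inter> F = out_edge D x `
            (if ?nx x - indeg x \<le> outdeg x then {1..?nx x - indeg x} - {k} else {1..outdeg x}))"
    proof -
      \<comment> \<open>At \<open>u\<close> both truncated differences are 0, because the pointer is
        still among the in-edges.\<close>
      have nx_eq: "?nx x - indeg x = nx x - indeg x" using i by auto
      show ?thesis
      \<comment> \<open>\<open>B\<close> changes only at an unvisited vertex, and there no out-edge
        has been passed, so the condition on \<open>B\<close> is vacuous.\<close>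
      proof (cases "vis x = 0")
        case True
        then have nx0: "nx x - indeg x = 0" using unvisited[OF x] by simp
        then have "sk x = 0 \<and> outs x \<inter> F = {}" using written_out[OF x] by simp
        then show ?thesis using nx0 unfolding nx_eq by simp
      next
        case False
        show ?thesis using written_out[OF x] unfolding nx_eq B_eq[OF False] .
      qed
    qed
    \<comment> \<open>The edge \<open>e\<close> from \<open>v\<close> to \<open>u\<close> extends
      the reversed trail, whose end moves from \<open>u\<close> to \<open>v\<close>.\<close>
    have "card (ins x \<inter> ?R) = card (ins x \<inter> R) + of_bool (x = u)"
      using eR eE hd finR by (auto simp: Int_insert_right)
    moreover have "card (outs x \<inter> ?R) = card (outs x \<inter> R) + of_bool (x = v)"
      using eR eE finR by (auto simp: v_def Int_insert_right)
    ultimately show "card (ins x \<inter> ?R) + of_bool (x = v) = card (outs x \<inter> ?R) + of_bool (x = b)"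
      using R_balance[OF x] by simp
    show "card (outs x \<inter> F) + of_bool (x = b) = card (ins x \<inter> F) + of_bool (x = v\<^sub>0)"
      by (rule F_balance[OF x])
    show "?nx x = 0" if "?vis x = 0" using that unvisited[OF x] u_visited by (auto split: if_splits)
    show "?vis x \<le> 1" using vis_le[OF x] by auto
    show "\<exists>e\<in>outs x. head (base D) e = ?B x" if "?vis x \<noteq> 0" "x \<noteq> v\<^sub>0"
    proof (cases "vis x = 0")
      case True
      then have "x = v" using that by (auto split: if_splits)
      then show ?thesis using True eE hd by (auto simp: v_def intro!: bexI[of _ e])
    next
      case False
      then show ?thesis using B_arc[OF x] that B_eq by auto
    qed
    show "(x, v\<^sub>0) \<in> {(y, ?B y) | y. y \<in> V \<and> ?vis y \<noteq> 0 \<and> y \<noteq> v\<^sub>0}\<^sup>*" (is "_ \<in> ?S\<^sup>*") if "?vis x \<noteq> 0"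
    proof -
      let ?T = "{(y, B y) | y. y \<in> V \<and> vis y \<noteq> 0 \<and> y \<noteq> v\<^sub>0}"
      \<comment> \<open>Old chains survive, since pointers of visited vertices are kept; the new
        vertex \<open>v\<close> is put in front of the chain of \<open>u\<close>.\<close>
      have "?T \<subseteq> ?S" using B_eq by auto
      then have old: "(y, v\<^sub>0) \<in> ?S\<^sup>*" if "y \<in> V" "vis y \<noteq> 0" for y
        using B_chain[OF that] rtrancl_mono by blast
      show ?thesis
      proof (cases "vis x = 0")
        case True
        then have xv: "x = v" using that by (auto split: if_splits)
        then have "(x, u) \<in> ?S" using True x v0v by auto
        then show ?thesis using old[OF u_vert u_visited] by (rule converse_rtrancl_into_rtrancl)
      next
        case False
        then show ?thesis using old x by blast
      qed
    qed
  next
    show "v\<^sub>0 \<in> V" "v \<in> V" "b \<in> V" "?R \<subseteq> E" "F \<subseteq> E" "?vis v\<^sub>0 \<noteq> 0" "?vis v \<noteq> 0"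
      using v0_vert vV b_vert R_arcs eE F_arcs v0_visited by auto
    show "?vis (tail (base D) f) \<noteq> 0" if "f \<in> ?R" for f
      using that R_tail by (auto simp: v_def)
    show "?B v\<^sub>0 = 0" using B_v0 v0v by auto
  qed
qed

text \<open>Common to all kinds of forward step. Only the record of written out-edges at
  \<open>u\<close> depends on the kind, so it is left to the caller, together with the new pointer
  \<open>N\<close> and the new flag \<open>S\<close>.\<close>

lemma forward_tour:
  assumes ge: "indeg u \<le> nx u"
    and e: "e \<in> outs u" "e \<notin> F"
    and N: "nx u \<le> N"
    and out: "S = 0 \<and> N - indeg u \<le> outdeg u \<and>
        (\<forall>i \<in> {1..N - indeg u}. Gamma_out D u i \<noteq> B u) \<and>
        outs u \<inter> insert e F = out_edge D u ` {1..N - indeg u} \<or>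
      S = 1 \<and> N - indeg u \<le> outdeg u + 1 \<and>
        (\<exists>k \<in> {1..outdeg u}. k < N - indeg u \<and> Gamma_out D u k = B u \<and>
          outs u \<inter> insert e F = out_edge D u `
            (if N - indeg u \<le> outdeg u then {1..N - indeg u} - {k} else {1..outdeg u}))"
  shows "tour D v\<^sub>0 (nx(u := N)) vis (sk(u := S)) B
    (head (base D) e) (head (base D) e) R (insert e F)"
proof -
  note b = forward_start[OF ge]
  let ?v = "head (base D) e" and ?F = "insert e F"
  have eE: "e \<in> E" and tl: "tail (base D) e = u" using e by auto
  have finF: "finite F" by (rule finite_subset[OF F_arcs finite_arcs])
  have vis_v: "vis ?v \<noteq> 0" using R_head b(2) e by blast
  show ?thesis
  proof unfold_locales
    fix x assume x: "x \<in> V"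
    show "ins x \<inter> R = in_edge D x ` {1..min ((nx(u := N)) x) (indeg x)}"
      using R_ins[OF x] ge order_trans[OF ge N] by (cases "x = u") (simp_all add: min_absorb2)
    show "(sk(u := S)) x = 0 \<and> (nx(u := N)) x - indeg x \<le> outdeg x \<and>
        (\<forall>i \<in> {1..(nx(u := N)) x - indeg x}. Gamma_out D x i \<noteq> B x) \<and>
        outs x \<inter> ?F = out_edge D x ` {1..(nx(u := N)) x - indeg x} \<or>
      (sk(u := S)) x = 1 \<and> (nx(u := N)) x - indeg x \<le> outdeg x + 1 \<and>
        (\<exists>k \<in> {1..outdeg x}. k < (nx(u := N)) x - indeg x \<and> Gamma_out D x k = B x \<and>
          outs x \<inter> ?F = out_edge D x `
            (if (nx(u := N)) x - indeg x \<le> outdeg x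
             then {1..(nx(u := N)) x - indeg x} - {k} else {1..outdeg x}))"
    proof (cases "x = u")
      case True
      show ?thesis using out unfolding True fun_upd_same .
    next
      case False
      then have eq: "outs x \<inter> ?F = outs x \<inter> F" using tl by auto
      show ?thesis using written_out[OF x] unfolding eq fun_upd_other[OF False] .
    qed
    \<comment> \<open>As \<open>b = u\<close>, the set \<open>R\<close> is balanced at every vertex,
      so its two coinciding ends may be moved to any vertex.\<close>
    show "card (ins x \<inter> R) + of_bool (x = ?v) = card (outs x \<inter> R) + of_bool (x = ?v)"
      using R_balance[OF x] b by simp
    have "card (outs x \<inter> ?F) = card (outs x \<inter> F) + of_bool (x = b)"
      using e eE finF b by (auto simp: Int_insert_right)
    moreover have "card (ins x \<inter> ?F) = card (ins x \<inter> F) + of_bool (x = ?v)"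
      using e eE finF by (auto simp: Int_insert_right)
    ultimately show "card (outs x \<inter> ?F) + of_bool (x = ?v) = card (ins x \<inter> ?F) + of_bool (x = v\<^sub>0)"
      using F_balance[OF x] by simp
    show "(nx(u := N)) x = 0" if "vis x = 0" using that unvisited[OF x] u_visited by auto
    show "vis x \<le> 1" by (rule vis_le[OF x])
    show "\<exists>e\<in>outs x. head (base D) e = B x" if "vis x \<noteq> 0" "x \<noteq> v\<^sub>0"
      by (rule B_arc[OF x that])
    show "(x, v\<^sub>0) \<in> {(y, B y) | y. y \<in> V \<and> vis y \<noteq> 0 \<and> y \<noteq> v\<^sub>0}\<^sup>*" if "vis x \<noteq> 0"
      by (rule B_chain[OF x that])
  next
    show "v\<^sub>0 \<in> V" "?v \<in> V" "R \<subseteq> E" "?F \<subseteq> E"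
      using v0_vert R_arcs eE F_arcs by auto
  qed (use vis_v v0_visited R_tail B_v0 eE in auto)
qed

text \<open>The cases follow the branches of \<open>forward_step\<close>; \<open>j\<close> counts
  the positions already passed among the out-edges. In \<open>skip_last\<close> the skipped edge is
  the final one in the ordering and is written in the same step. Since \<open>F \<noteq> E\<close>,
  some out-edge of \<open>u\<close> is unwritten by \<open>all_written\<close>, so each step writes
  a fresh edge.\<close>

lemma forward_cases:
  assumes nx_u: "nx u = indeg u + j" and F: "F \<noteq> E"
  obtains
      (plain) e where "j < outdeg u" "Gamma_out D u (Suc j) \<noteq> B u \<or> sk u \<noteq> 0"
        "e \<in> outs u - F" "head (base D) e = Gamma_out D u (Suc j)"
        "tour D v\<^sub>0 (nx(u := Suc (nx u))) vis sk B (head (base D) e) (head (base D) e) R (insert e F)"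
    | (skip) e where "Suc j < outdeg u" "Gamma_out D u (Suc j) = B u" "sk u = 0"
        "e \<in> outs u - F" "head (base D) e = Gamma_out D u (Suc (Suc j))"
        "tour D v\<^sub>0 (nx(u := Suc (Suc (nx u)))) vis (sk(u := 1)) B
           (head (base D) e) (head (base D) e) R (insert e F)"
    | (skip_last) e where "Suc j = outdeg u" "Gamma_out D u (Suc j) = B u" "sk u = 0"
        "e \<in> outs u - F" "head (base D) e = B u"
        "tour D v\<^sub>0 (nx(u := Suc (Suc (nx u)))) vis (sk(u := 1)) B
           (head (base D) e) (head (base D) e) R (insert e F)"
    | (last) e where "j = outdeg u" "e \<in> outs u - F" "head (base D) e = B u"
        "tour D v\<^sub>0 (nx(u := Suc (nx u))) vis sk B (head (base D) e) (head (base D) e) R (insert e F)"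
proof -
  have ge: "indeg u \<le> nx u" and j_def: "j = nx u - indeg u" using nx_u by auto
  have nall: "outs u \<inter> F \<noteq> outs u" using all_written forward_start[OF ge] F by auto
  have j1: "Suc (nx u) - indeg u = Suc j" and j2: "Suc (Suc (nx u)) - indeg u = Suc (Suc j)"
    using ge by (auto simp: j_def)
  note eq = out_edge_eq_iff[OF u_vert]
  note mem = out_edge_in_outs[OF u_vert]
  note all = outs_eq_image[OF u_vert]
  \<comment> \<open>Injectivity of the numbering: an index outside the written ones gives an
    unwritten edge.\<close>
  have fresh: "out_edge D u i \<notin> F"
    if "outs u \<inter> F = out_edge D u ` I" "I \<subseteq> {1..outdeg u}" "i \<in> {1..outdeg u}" "i \<notin> I" for I i
  proof
    assume "out_edge D u i \<in> F"
    then have "out_edge D u i \<in> out_edge D u ` I" using that mem by blast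
    then obtain i' where "i' \<in> I" "out_edge D u i = out_edge D u i'" by auto
    then show False using eq[OF that(3), of i'] that by auto
  qed
  from u_vert show thesis
  proof (cases rule: written_out_cases)
    case unskipped
    note no = unskipped[folded j_def]
    \<comment> \<open>With nothing skipped, \<open>j = outdeg u\<close> would mean that all
      out-edges are written.\<close>
    have jlt: "j < outdeg u" using no nall all[symmetric] by (cases "j = outdeg u") simp_all
    let ?e = "out_edge D u (Suc j)" and ?e' = "out_edge D u (Suc (Suc j))"
    have e: "?e \<in> outs u" "?e \<notin> F" using mem jlt fresh[OF no(4)] by auto
    show thesis
    proof (cases "Gamma_out D u (Suc j) = B u")
      case False
      have Suc_j: "{1..Suc j} = insert (Suc j) {1..j}" by auto
      then have "outs u \<inter> insert ?e F = out_edge D u ` {1..Suc j}"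
        using no(4) e by (simp add: Int_insert_right)
      moreover have "\<forall>i \<in> {1..Suc j}. Gamma_out D u i \<noteq> B u"
        using no(3) False unfolding Suc_j by simp
      ultimately have "tour D v\<^sub>0 (nx(u := Suc (nx u))) vis (sk(u := 0)) B
          (head (base D) ?e) (head (base D) ?e) R (insert ?e F)"
        using jlt by (intro forward_tour[OF ge e] disjI1 conjI) (simp_all only: j1 Suc_leI le_SucI)
      moreover have "sk(u := 0) = sk" using no(1) by (rule fun_upd_idem)
      ultimately have "tour D v\<^sub>0 (nx(u := Suc (nx u))) vis sk B
          (head (base D) ?e) (head (base D) ?e) R (insert ?e F)" by (simp only:)
      with e show thesis
        by (intro plain[OF jlt disjI1[OF False], of ?e]) (auto simp: Gamma_out_def)
    next
      case True
      show thesis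
      proof (cases "Suc j < outdeg u")
        case less: True
        have e': "?e' \<in> outs u" "?e' \<notin> F" using mem less fresh[OF no(4)] by auto
        have "{1..Suc (Suc j)} - {Suc j} = insert (Suc (Suc j)) {1..j}" by auto
        then have "outs u \<inter> insert ?e' F = out_edge D u ` ({1..Suc (Suc j)} - {Suc j})"
          using no(4) e' by (simp add: Int_insert_right)
        then have "tour D v\<^sub>0 (nx(u := Suc (Suc (nx u)))) vis (sk(u := 1)) B
            (head (base D) ?e') (head (base D) ?e') R (insert ?e' F)"
          using less True
          by (intro forward_tour[OF ge e'] disjI2 conjI bexI[of _ "Suc j"]) (simp_all add: j2)
        with e' show thesis
          by (intro skip[OF less True no(1), of ?e']) (auto simp: Gamma_out_def)
      next
        case False
        then have last': "Suc j = outdeg u" using jlt by auto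
        \<comment> \<open>The pointer jumps to \<open>outdeg u + 1\<close>, where the invariant
          counts the skipped edge as written.\<close>
        have "{1..outdeg u} = insert (Suc j) {1..j}" using last' by auto
        then have "outs u \<inter> insert ?e F = out_edge D u ` {1..outdeg u}"
          using no(4) e by (simp add: Int_insert_right)
        then have "tour D v\<^sub>0 (nx(u := Suc (Suc (nx u)))) vis (sk(u := 1)) B
            (head (base D) ?e) (head (base D) ?e) R (insert ?e F)"
          using last' True
          by (intro forward_tour[OF ge e] disjI2 conjI bexI[of _ "Suc j"]) (simp_all add: j2)
        with e show thesis
          by (intro skip_last[OF last' True no(1), of ?e]) (auto simp: Gamma_out_def True[symmetric])
      qed
    qed
  next
    case (skipped k)
    note yes = skipped[folded j_def]
    \<comment> \<open>The value \<open>outdeg u + 1\<close> would mean that the skipped edge, too,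
      is written.\<close>
    have jle: "j \<le> outdeg u" using yes nall all by (auto split: if_splits)
    have F_eq: "outs u \<inter> F = out_edge D u ` ({1..j} - {k})" using yes jle by simp
    have sub: "{1..j} - {k} \<subseteq> {1..outdeg u}" using jle by auto
    have sk1: "sk(u := 1) = sk" using yes(1) by (rule fun_upd_idem)
    show thesis
    proof (cases "j < outdeg u")
      case True
      let ?e = "out_edge D u (Suc j)"
      have e: "?e \<in> outs u" "?e \<notin> F" using mem True fresh[OF F_eq sub, of "Suc j"] by auto
      have "{1..Suc j} - {k} = insert (Suc j) ({1..j} - {k})" using yes by auto
      then have "outs u \<inter> insert ?e F = out_edge D u ` ({1..Suc j} - {k})"
        using F_eq e by (simp add: Int_insert_right)
      then have "tour D v\<^sub>0 (nx(u := Suc (nx u))) vis (sk(u := 1)) B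
          (head (base D) ?e) (head (base D) ?e) R (insert ?e F)"
        using True yes
        by (intro forward_tour[OF ge e] disjI2 conjI bexI[of _ k]) (simp_all add: j1)
      with e yes(1) show thesis
        by (intro plain[OF True, of ?e]) (auto simp only: Gamma_out_def sk1)
    next
      case False
      then have j: "j = outdeg u" using jle by simp
      \<comment> \<open>The program writes only the pair \<open>u\<close>, \<open>B u\<close>; the
        skipped edge \<open>k\<close> is the edge that this pair stands for.\<close>
      let ?e = "out_edge D u k"
      have e: "?e \<in> outs u" "?e \<notin> F" using mem yes(3) fresh[OF F_eq sub yes(3)] by auto
      have "{1..outdeg u} = insert k ({1..j} - {k})" using yes j by auto
      then have "outs u \<inter> insert ?e F = out_edge D u ` {1..outdeg u}"
        using F_eq e by (metis Int_insert_right image_insert)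
      then have "tour D v\<^sub>0 (nx(u := Suc (nx u))) vis (sk(u := 1)) B
          (head (base D) ?e) (head (base D) ?e) R (insert ?e F)"
        using j yes
        by (intro forward_tour[OF ge e] disjI2 conjI bexI[of _ k]) (simp_all add: j1)
      with e yes(5) show thesis
        by (intro last[OF j, of ?e]) (auto simp only: Gamma_out_def sk1)
    qed
  qed
qed

end

section \<open>Weakest preconditions with time bounds\<close>

text \<open>The integers occurring in a run are at most \<open>2 * m + 4\<close>, hence fit into four words.\<close>

definition affordable :: "'e ordered_digraph \<Rightarrow> operation \<Rightarrow> bool" where
  "affordable D op \<longleftrightarrow> (case op_integers op of
       Some X \<Rightarrow> \<forall>x \<in> X. x \<le> 2 * num_arcs D + 4
     | None \<Rightarrow> op \<in> Op_out_degree ` verts (base D) \<union> Op_in_degree ` verts (base D) \<union>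
         {Op_out_head v i | v i. v \<in> verts (base D) \<and> i \<in> {1..out_degree (base D) v}} \<union>
         {Op_in_tail v i | v i. v \<in> verts (base D) \<and> i \<in> {1..in_degree (base D) v}})"

lemma affordable_simps [simp]:
  "affordable D (Op_load x) \<longleftrightarrow> x \<le> 2 * num_arcs D + 4"
  "affordable D (Op_store x) \<longleftrightarrow> x \<le> 2 * num_arcs D + 4"
  "affordable D (Op_load_elem i x) \<longleftrightarrow> i \<le> 2 * num_arcs D + 4 \<and> x \<le> 2 * num_arcs D + 4"
  "affordable D (Op_store_elem i x) \<longleftrightarrow> i \<le> 2 * num_arcs D + 4 \<and> x \<le> 2 * num_arcs D + 4"
  "affordable D (Op_add x y) \<longleftrightarrow> x + y \<le> 2 * num_arcs D + 4"
  "affordable D (Op_sub x y) \<longleftrightarrow> x \<le> 2 * num_arcs D + 4 \<and> y \<le> 2 * num_arcs D + 4"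
  "affordable D (Op_compare x y) \<longleftrightarrow> x \<le> 2 * num_arcs D + 4 \<and> y \<le> 2 * num_arcs D + 4"
  "affordable D Op_branch"
  "affordable D (Op_write x y) \<longleftrightarrow> x \<le> 2 * num_arcs D + 4 \<and> y \<le> 2 * num_arcs D + 4"
  "affordable D (Op_out_degree x) \<longleftrightarrow> x \<in> verts (base D)"
  "affordable D (Op_in_degree x) \<longleftrightarrow> x \<in> verts (base D)"
  "affordable D (Op_out_head x i) \<longleftrightarrow> x \<in> verts (base D) \<and> i \<in> {1..out_degree (base D) x}"
  "affordable D (Op_in_tail x i) \<longleftrightarrow> x \<in> verts (base D) \<and> i \<in> {1..in_degree (base D) x}"
  by (auto simp: affordable_def)

text \<open>Put \<open>q = 2 ^ word_length D\<close>. Then \<open>m \<le> q\<close> and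
  \<open>2 \<le> q\<close>, so \<open>2 * m + 4 \<le> 4 * q \<le> q ^ 3 < q ^ 4\<close>. Three words
  would not do: for \<open>m = 2\<close> both sides are 8.\<close>

lemma num_arcs_less_word:
  "2 * num_arcs D + 4 < 2 ^ (4 * word_length D)"
proof -
  let ?m = "num_arcs D" and ?w = "word_length D"
  have w: "1 \<le> ?w" by (simp add: word_length_def)
  have m: "?m \<le> 2 ^ ?w"
  proof (cases "?m = 0")
    case False
    have "log 2 (real ?m) \<le> real ?w"
      unfolding word_length_def by linarith
    then have "real ?m \<le> 2 powr real ?w"
      using False by (simp add: log_le_iff)
    then have "real ?m \<le> real (2 ^ ?w)" by (simp add: powr_realpow)
    then show ?thesis by (simp only: of_nat_le_iff)
  qed simp
  let ?q = "(2::nat) ^ ?w"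
  have q: "2 \<le> ?q" using power_increasing[OF w, of "2::nat"] by simp
  have "2 * ?q + 4 \<le> 4 * ?q" using q by simp
  also have "\<dots> \<le> ?q * ?q * ?q" using mult_le_mono[OF mult_le_mono[OF q q], of ?q ?q] by simp
  also have "\<dots> < ?q * ?q * ?q * ?q" using q by simp
  also have "\<dots> = 2 ^ (4 * ?w)" by (simp add: power_mult[symmetric] power4_eq_xxxx mult.commute[of 4 ?w] power_mult)
  finally show ?thesis using m by linarith
qed

text \<open>\<open>K\<close> is the larger of the arithmetic constant for four words and the graph
  access constant. Both are uniform in the graph.\<close>

lemma affordable_cost:
  assumes "constant_time_arithmetic cost" "constant_time_graph_access cost"
  obtains K where "\<And>D op. ordered_eulerian D \<Longrightarrow> affordable D op \<Longrightarrow> cost D op \<le> K"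
proof -
  obtain K1 where K1: "\<And>D op X. ordered_eulerian D \<Longrightarrow> op_integers op = Some X \<Longrightarrow>
      (\<forall>x \<in> X. x < 2 ^ (4 * word_length D)) \<Longrightarrow> cost D op \<le> K1"
    using assms(1) unfolding constant_time_arithmetic_def by metis
  obtain K2 where K2: "\<And>D v. ordered_eulerian D \<Longrightarrow> v \<in> verts (base D) \<Longrightarrow>
        cost D (Op_out_degree v) \<le> K2 \<and> cost D (Op_in_degree v) \<le> K2 \<and>
        (\<forall>i \<in> {1..out_degree (base D) v}. cost D (Op_out_head v i) \<le> K2) \<and>
        (\<forall>i \<in> {1..in_degree (base D) v}. cost D (Op_in_tail v i) \<le> K2)"
    using assms(2) unfolding constant_time_graph_access_def by metis
  have "cost D op \<le> max K1 K2" if D: "ordered_eulerian D" and a: "affordable D op" for D op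
  proof (cases "op_integers op")
    case (Some X)
    then have "\<forall>x \<in> X. x < 2 ^ (4 * word_length D)"
      using a num_arcs_less_word[of D] by (auto simp: affordable_def)
    then show ?thesis using K1[OF D Some] by (simp add: max.coboundedI1)
  next
    case None
    then show ?thesis using a K2[OF D] by (auto simp: affordable_def intro: max.coboundedI2)
  qed
  then show thesis by (rule that)
qed

text \<open>Total correctness: a run must exist, and by \<open>exec_deterministic\<close> it is the
  only one. Operation counts are kept out, so that the simplifier can evaluate \<open>wp\<close> on
  loop-free code.\<close>

definition wp :: "'e ordered_digraph \<Rightarrow> com \<Rightarrow> (state \<Rightarrow> bool) \<Rightarrow> state \<Rightarrow> bool" where
  "wp D c Q s \<longleftrightarrow> (\<exists>p s'. exec D c s p s' \<and> list_all (affordable D) p \<and> Q s')"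

definition wp_within ::
  "'e ordered_digraph \<Rightarrow> nat \<Rightarrow> com \<Rightarrow> (state \<Rightarrow> bool) \<Rightarrow> state \<Rightarrow> bool" where
  "wp_within D t c Q s \<longleftrightarrow>
     (\<exists>p s'. exec D c s p s' \<and> list_all (affordable D) p \<and> length p \<le> t \<and> Q s')"

section \<open>Symbolic execution of loop-free programs\<close>

lemma wp_Skip [simp]: "wp D Skip Q s \<longleftrightarrow> Q s"
proof -
  have "exec D Skip s p s' \<longleftrightarrow> p = [] \<and> s' = s" for p s'
    by (subst exec.simps) auto
  then show ?thesis by (simp add: wp_def)
qed

lemma wp_Seq [simp]: "wp D (Seq c1 c2) Q s \<longleftrightarrow> wp D c1 (wp D c2 Q) s"
proof -
  have "exec D (Seq c1 c2) s p s' \<longleftrightarrow>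
      (\<exists>q t r. exec D c1 s q t \<and> exec D c2 t r s' \<and> p = q @ r)" for p s'
    by (subst exec.simps) auto
  then show ?thesis by (simp add: wp_def) (use list_all_append in blast)
qed

lemma wp_Assign [simp]:
  "wp D (Assign a e) Q s \<longleftrightarrow> (case aval D s e of
     Some (x, p) \<Rightarrow> list_all (affordable D) p \<and> affordable D (Op_store x) \<and>
       Q (s\<lparr>scalar := (scalar s)(a := x)\<rparr>)
   | None \<Rightarrow> False)"
proof -
  have "exec D (Assign a e) s p s' \<longleftrightarrow> (\<exists>x q. aval D s e = Some (x, q) \<and>
      p = q @ [Op_store x] \<and> s' = s\<lparr>scalar := (scalar s)(a := x)\<rparr>)" for p s'
    by (subst exec.simps) auto
  then show ?thesis by (auto simp: wp_def split: option.split)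
qed

lemma wp_AssignElem [simp]:
  "wp D (AssignElem a e f) Q s \<longleftrightarrow> (case aval D s e of
     Some (i, p) \<Rightarrow> (case aval D s f of
       Some (x, q) \<Rightarrow> list_all (affordable D) (p @ q) \<and> i \<in> {1..num_verts D} \<and>
         affordable D (Op_store_elem i x) \<and>
         Q (s\<lparr>array := (array s)(a := (array s a)(i := x))\<rparr>)
     | None \<Rightarrow> False)
   | None \<Rightarrow> False)"
proof -
  have "exec D (AssignElem a e f) s p s' \<longleftrightarrow> (\<exists>i q x q'. aval D s e = Some (i, q) \<and>
      aval D s f = Some (x, q') \<and> i \<in> {1..num_verts D} \<and> p = q @ q' @ [Op_store_elem i x] \<and>
      s' = s\<lparr>array := (array s)(a := (array s a)(i := x))\<rparr>)" for p s'
    by (subst exec.simps) auto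
  then show ?thesis by (auto simp: wp_def split: option.split)
qed

lemma wp_Write [simp]:
  "wp D (Write e f) Q s \<longleftrightarrow> (case aval D s e of
     Some (x, p) \<Rightarrow> (case aval D s f of
       Some (y, q) \<Rightarrow> list_all (affordable D) (p @ q) \<and> affordable D (Op_write x y) \<and>
         Q (s\<lparr>written := written s @ [(x, y)]\<rparr>)
     | None \<Rightarrow> False)
   | None \<Rightarrow> False)"
proof -
  have "exec D (Write e f) s p s' \<longleftrightarrow> (\<exists>x q y q'. aval D s e = Some (x, q) \<and>
      aval D s f = Some (y, q') \<and> p = q @ q' @ [Op_write x y] \<and>
      s' = s\<lparr>written := written s @ [(x, y)]\<rparr>)" for p s'
    by (subst exec.simps) auto
  then show ?thesis by (auto simp: wp_def split: option.split)
qed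

lemma wp_If [simp]:
  "wp D (If b c1 c2) Q s \<longleftrightarrow> (case bval D s b of
     Some (r, p) \<Rightarrow> list_all (affordable D) p \<and> (if r then wp D c1 Q s else wp D c2 Q s)
   | None \<Rightarrow> False)" (is "?L \<longleftrightarrow> ?R")
proof
  assume ?L
  then obtain p s' where "exec D (If b c1 c2) s p s'" "list_all (affordable D) p" "Q s'"
    unfolding wp_def by blast
  then show ?R by (elim exec_IfE) (auto simp: wp_def)
next
  assume ?R
  then obtain r p where b: "bval D s b = Some (r, p)" "list_all (affordable D) p"
    and br: "if r then wp D c1 Q s else wp D c2 Q s" by (auto split: option.splits)
  from br obtain q s' where q: "list_all (affordable D) q" "Q s'"
    and ex: "if r then exec D c1 s q s' else exec D c2 s q s'"
    by (auto simp: wp_def split: if_splits)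
  from ex have "exec D (If b c1 c2) s (p @ [Op_branch] @ q) s'"
    using b(1) exec_If_True exec_If_False by (cases r) (simp_all only: if_True if_False)
  then show ?L using b(2) q unfolding wp_def
    by (intro exI[of _ "p @ [Op_branch] @ q"] exI[of _ s']) simp
qed

section \<open>Syntactic bounds on the number of operations\<close>

fun aops :: "aexp \<Rightarrow> nat" where
  "aops (Const k) = 1"
| "aops (Var x) = 1"
| "aops (Elem a e) = aops e + 1"
| "aops (Plus e f) = aops e + aops f + 1"
| "aops (Minus e f) = aops e + aops f + 1"
| "aops (OutDeg e) = aops e + 1"
| "aops (InDeg e) = aops e + 1"
| "aops (OutHead e f) = aops e + aops f + 1"
| "aops (InTail e f) = aops e + aops f + 1"

fun bops :: "bexp \<Rightarrow> nat" where
  "bops (Eq e f) = aops e + aops f + 1"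
| "bops (Le e f) = aops e + aops f + 1"
| "bops (Not b) = bops b + 1"
| "bops (And b c) = bops b + bops c + 1"

fun loop_free :: "com \<Rightarrow> bool" where
  "loop_free (Seq c1 c2) \<longleftrightarrow> loop_free c1 \<and> loop_free c2"
| "loop_free (If b c1 c2) \<longleftrightarrow> loop_free c1 \<and> loop_free c2"
| "loop_free (While b c) \<longleftrightarrow> False"
| "loop_free _ \<longleftrightarrow> True"

text \<open>An upper bound for loop-free programs only: both branches of \<open>If\<close> are added
  up, and the value at \<open>While\<close> is a dummy.\<close>

fun cops :: "com \<Rightarrow> nat" where
  "cops Skip = 0"
| "cops (Assign a e) = aops e + 1"
| "cops (AssignElem a e f) = aops e + aops f + 1"
| "cops (Write e f) = aops e + aops f + 1"
| "cops (Seq c1 c2) = cops c1 + cops c2"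
| "cops (If b c1 c2) = bops b + 1 + cops c1 + cops c2"
| "cops (While b c) = 0"

lemma length_aval: "aval D s e = Some (x, p) \<Longrightarrow> length p \<le> aops e"
proof (induction e arbitrary: x p)
qed (fastforce split: Option.bind_splits if_splits)+

lemma length_bval: "bval D s b = Some (r, p) \<Longrightarrow> length p \<le> bops b"
proof (induction b arbitrary: r p)
qed (fastforce split: Option.bind_splits if_splits dest: length_aval)+

lemma length_exec: "exec D c s p s' \<Longrightarrow> loop_free c \<Longrightarrow> length p \<le> cops c"
proof (induction rule: exec.induct)
qed (fastforce dest: length_aval length_bval)+

lemma wp_within_loop_free: "loop_free c \<Longrightarrow> wp D c Q s \<Longrightarrow> wp_within D (cops c) c Q s"
  unfolding wp_def wp_within_def using length_exec by blast

lemma wp_within_Seq: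
  assumes "wp_within D t1 c1 P s" "\<And>s. P s \<Longrightarrow> wp_within D t2 c2 Q s"
  shows "wp_within D (t1 + t2) (Seq c1 c2) Q s"
proof -
  obtain p s' where 1: "exec D c1 s p s'" "list_all (affordable D) p" "length p \<le> t1" "P s'"
    using assms(1) by (auto simp: wp_within_def)
  moreover obtain q s'' where 2: "exec D c2 s' q s''" "list_all (affordable D) q" "length q \<le> t2" "Q s''"
    using assms(2)[OF 1(4)] by (auto simp: wp_within_def)
  ultimately show ?thesis
    unfolding wp_within_def using exec_Seq[OF 1(1) 2(1)]
    by (intro exI[of _ "p @ q"] exI[of _ s'']) simp
qed

text \<open>The index of \<open>I\<close> is a potential that each iteration lowers by one and that
  is positive whenever the guard holds. So there are at most \<open>k\<close> iterations and
  \<open>k + 1\<close> tests. The final potential is left open, because the loop ends when the guard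
  fails and not when the potential reaches 0.\<close>

lemma wp_within_While:
  assumes step: "\<And>k s. I k s \<Longrightarrow> \<exists>r p. bval D s b = Some (r, p) \<and> list_all (affordable D) p \<and>
      (r \<longrightarrow> 0 < k \<and> wp D c (I (k - 1)) s)"
    and c: "loop_free c" and I: "I k s"
  shows "wp_within D ((k + 1) * (bops b + 1 + cops c)) (While b c)
    (\<lambda>s'. (\<exists>k. I k s') \<and> (\<exists>p. bval D s' b = Some (False, p))) s"
  using I
proof (induction k arbitrary: s rule: less_induct)
  case (less k)
  let ?Q = "\<lambda>s'. (\<exists>k. I k s') \<and> (\<exists>p. bval D s' b = Some (False, p))"
  from step[OF less.prems] obtain r p where r: "bval D s b = Some (r, p)" "list_all (affordable D) p"
    "r \<Longrightarrow> 0 < k" "r \<Longrightarrow> wp D c (I (k - 1)) s" by blast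
  have p: "length p \<le> bops b" using length_bval r(1) by blast
  show ?case
  proof (cases r)
    case False
    have "exec D (While b c) s (p @ [Op_branch]) s"
      by (rule exec_While_False) (use r(1) False in simp)
    then show ?thesis unfolding wp_within_def
      using less.prems r(1,2) p False by (intro exI[of _ "p @ [Op_branch]"] exI[of _ s]) auto
  next
    case True
    then obtain j where k: "k = Suc j" using r(3) by (cases k) auto
    obtain q s' where q: "exec D c s q s'" "list_all (affordable D) q" "length q \<le> cops c" "I j s'"
      using wp_within_loop_free[OF c r(4)[OF True]] k by (auto simp: wp_within_def)
    obtain w s'' where w: "exec D (While b c) s' w s''" "list_all (affordable D) w"
      "length w \<le> (j + 1) * (bops b + 1 + cops c)" "?Q s''"
      using less.IH[OF _ q(4)] k unfolding wp_within_def by blast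
    have "exec D (While b c) s (p @ [Op_branch] @ q @ w) s''"
      
      by (rule exec_While_True[OF _ q(1) w(1)]) (use r(1) True in simp)
    moreover have "length (p @ [Op_branch] @ q @ w) \<le> (k + 1) * (bops b + 1 + cops c)"
      using p q(3) w(3) k by simp
    moreover have "list_all (affordable D) (p @ [Op_branch] @ q @ w)"
      using r(2) q(2) w(2) by simp
    ultimately show ?thesis unfolding wp_within_def using w(4) by blast
  qed
qed

section \<open>Running time of the algorithm\<close>

definition main_body :: com where
  "main_body = seqs [
     AssignElem Arr_next (Var Var_u) (Plus (Elem Arr_next (Var Var_u)) (Const 1)),
     Assign Var_i (Elem Arr_next (Var Var_u)),
     If (Le (Var Var_i) (InDeg (Var Var_u))) backward_step forward_step]"

definition init_body :: com where
  "init_body = seqs [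
     AssignElem Arr_next (Var Var_j) (Const 0),
     AssignElem Arr_visited (Var Var_j) (Const 0),
     AssignElem Arr_skipped (Var Var_j) (Const 0),
     AssignElem Arr_B (Var Var_j) (Const 0),
     Assign Var_j (Plus (Var Var_j) (Const 1))]"

text \<open>The potential \<open>k\<close> is the number of edge traversals, backward or forward,
  that are still available out of \<open>2 * m\<close>.\<close>

definition main_inv :: "'e ordered_digraph \<Rightarrow> nat \<Rightarrow> nat \<Rightarrow> state \<Rightarrow> bool" where
  "main_inv D v\<^sub>0 k s \<longleftrightarrow> scalar s Var_m = num_arcs D \<and> scalar s Var_v0 = v\<^sub>0 \<and>
     (\<exists>b R F. tour D v\<^sub>0 (array s Arr_next) (array s Arr_visited) (array s Arr_skipped)
        (array s Arr_B) (scalar s Var_u) b R F \<and>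
      scalar s Var_c = card F \<and> card R + card F + k = 2 * num_arcs D)"

text \<open>The potential \<open>k\<close> is the number of indices that are still to be
  cleared.\<close>

definition init_inv :: "'e ordered_digraph \<Rightarrow> nat \<Rightarrow> nat \<Rightarrow> state \<Rightarrow> bool" where
  "init_inv D v\<^sub>0 k s \<longleftrightarrow> scalar s Var_n = num_verts D \<and> scalar s Var_m = num_arcs D \<and>
     scalar s Var_v0 = v\<^sub>0 \<and> 1 \<le> scalar s Var_j \<and> scalar s Var_j + k = num_verts D + 1 \<and>
     (\<forall>a. \<forall>x \<in> {1..<scalar s Var_j}. array s a x = 0)"

section \<open>One iteration of the main loop\<close>

context tour
begin

lemma verts_bounds:
  assumes "x \<in> V"
  shows "Suc 0 \<le> x" "x \<le> num_verts D" "x \<le> 2 * num_arcs D + 4"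
proof -
  show "x \<le> num_verts D" using vert_le_num_verts[OF assms] .
  then show "x \<le> 2 * num_arcs D + 4" using num_verts_le_linear by linarith
  show "Suc 0 \<le> x" using assms zero_notin_verts by (cases x) auto
qed

lemma card_R_le: "card R \<le> num_arcs D" and card_F_le: "card F \<le> num_arcs D"
  using R_arcs F_arcs by (auto intro: card_mono)

lemma backward_exec:
  assumes st: "array s Arr_next = nx" "array s Arr_visited = vis" "array s Arr_skipped = sk"
      "array s Arr_B = B" "scalar s Var_u = u" "scalar s Var_m = num_arcs D" "scalar s Var_v0 = v\<^sub>0"
      "scalar s Var_c = card F"
    and k: "card R + card F + k = 2 * num_arcs D"
    and i: "Suc (nx u) \<le> indeg u"
  shows "0 < k \<and> wp D main_body (main_inv D v\<^sub>0 (k - 1)) s"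
proof -
  define e where "e = in_edge D u (Suc (nx u))"
  define v where "v = tail (base D) e"
  note bt = backward_tour[OF i, folded e_def, folded v_def]
  interpret t: tour D v\<^sub>0 "nx(u := Suc (nx u))" "vis(v := 1)" sk
    "if vis v = 0 then B(v := u) else B" v b "insert e R" F by (rule bt(3))
  have "card (insert e R) = card R + 1"
    using bt(1) finite_subset[OF R_arcs finite_arcs] by simp
  \<comment> \<open>The new \<open>R\<close> and \<open>F\<close> still fit into \<open>E\<close>,
    so the old potential was positive.\<close>
  then have k': "0 < k" "card (insert e R) + card F + (k - 1) = 2 * num_arcs D"
    using k t.card_R_le card_F_le by auto
  have G: "Gamma_in D u (Suc (nx u)) = v" by (simp add: Gamma_in_def v_def e_def)
  have B1: "nx u \<le> 2 * num_arcs D + 3" "indeg u \<le> 2 * num_arcs D + 4"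
    using i indeg_le_num_arcs[of u] by auto
  \<comment> \<open>At a visited \<open>v\<close> the program stores nothing, whereas
    \<open>backward_tour\<close> sets the entry to 1. The two agree because entries of
    \<open>vis\<close> are at most 1.\<close>
  have vis1: "vis v \<noteq> 0 \<Longrightarrow> vis(v := Suc 0) = vis"
    using vis_le[OF t.u_vert] by (intro fun_upd_idem) simp
  have vv0: "vis v = 0 \<Longrightarrow> v \<noteq> v\<^sub>0" using v0_visited by auto
  have vis_b: "vis v \<le> 2 * num_arcs D + 4" using vis_le[OF t.u_vert] by simp
  show ?thesis
  proof (intro conjI k'(1))
    show "wp D main_body (main_inv D v\<^sub>0 (k - 1)) s"
    proof (cases "vis v = 0")
      case True
      \<comment> \<open>Phrased through the components of the state, to fit the nested updates that
        symbolic execution produces.\<close>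
      have "main_inv D v\<^sub>0 (k - 1) s'"
        if "array s' Arr_next = nx(u := Suc (nx u))" "array s' Arr_visited = vis(v := Suc 0)"
          "array s' Arr_skipped = sk" "array s' Arr_B = B(v := u)" "scalar s' Var_u = v"
          "scalar s' Var_m = num_arcs D" "scalar s' Var_v0 = v\<^sub>0" "scalar s' Var_c = card F" for s'
        using that bt(3) True k'(2) unfolding main_inv_def by auto
      then show ?thesis
        unfolding main_body_def backward_step_def
        using i B1 vis_b True vv0[OF True] verts_bounds[OF u_vert] verts_bounds[OF t.u_vert]
          verts_bounds[OF v0_vert] u_vert
        by (simp add: st G)
    next
      case False
      have "main_inv D v\<^sub>0 (k - 1) s'"
        if "array s' Arr_next = nx(u := Suc (nx u))" "array s' Arr_visited = vis"
          "array s' Arr_skipped = sk" "array s' Arr_B = B" "scalar s' Var_u = v"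
          "scalar s' Var_m = num_arcs D" "scalar s' Var_v0 = v\<^sub>0" "scalar s' Var_c = card F" for s'
        using that bt(3) False vis1 k'(2) unfolding main_inv_def by auto
      then show ?thesis
        unfolding main_body_def backward_step_def
        using i B1 vis_b False verts_bounds[OF u_vert] verts_bounds[OF t.u_vert] u_vert
        by (simp add: st G)
    qed
  qed
qed

lemma forward_exec:
  assumes st: "array s Arr_next = nx" "array s Arr_visited = vis" "array s Arr_skipped = sk"
      "array s Arr_B = B" "scalar s Var_u = u" "scalar s Var_m = num_arcs D" "scalar s Var_v0 = v\<^sub>0"
      "scalar s Var_c = card F"
    and k: "card R + card F + k = 2 * num_arcs D"
    and ge: "indeg u \<le> nx u" and F: "card F < num_arcs D"
  shows "0 < k \<and> wp D main_body (main_inv D v\<^sub>0 (k - 1)) s"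
proof
  show "0 < k" using k F card_R_le by simp
  define j where "j = nx u - indeg u"
  have nx_u: "nx u = indeg u + j" using ge by (simp add: j_def)
  have inv: "main_inv D v\<^sub>0 (k - Suc 0) s'"
    if "e \<in> outs u - F"
      "tour D v\<^sub>0 nx' vis sk' B (head (base D) e) (head (base D) e) R (insert e F)"
      "array s' Arr_next = nx'" "array s' Arr_visited = vis" "array s' Arr_skipped = sk'"
      "array s' Arr_B = B" "scalar s' Var_u = head (base D) e"
      "scalar s' Var_m = num_arcs D" "scalar s' Var_v0 = v\<^sub>0"
      "scalar s' Var_c = Suc (card F)" for e s' nx' sk'
  proof -
    have "card (insert e F) = Suc (card F)"
      using that(1) finite_subset[OF F_arcs finite_arcs] by simp
    moreover have "card R + Suc (card F) + (k - Suc 0) = 2 * num_arcs D" using k \<open>0 < k\<close> by simp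
    ultimately show ?thesis using that unfolding main_inv_def by metis
  qed
  \<comment> \<open>The new pointer is at most \<open>indeg u + outdeg u + 1\<close>, hence at most
    \<open>2 * m + 1\<close> and affordable.\<close>
  have B1: "indeg u \<le> num_arcs D" "outdeg u \<le> num_arcs D"
    using indeg_le_num_arcs outdeg_le_num_arcs by auto
  have B2: "sk u \<le> 1" "B u \<le> 2 * num_arcs D + 4"
    using sk_le[OF u_vert] B_le[OF u_vert u_visited] num_verts_le_linear by auto
  have F': "F \<noteq> E" using F by auto
  have ub: "Suc 0 \<le> u" "u \<le> num_verts D" "u \<le> 2 * num_arcs D + 4" "u \<in> V"
    using verts_bounds[OF u_vert] u_vert by auto
  have Gb: "Gamma_out D u i \<le> 2 * num_arcs D + 4" if "Suc 0 \<le> i" "i \<le> outdeg u" for i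
    using out_edge_in_outs[OF u_vert, of i] that verts_bounds(3) by (auto simp: Gamma_out_def)
  from nx_u F' show "wp D main_body (main_inv D v\<^sub>0 (k - 1)) s"
  proof (cases rule: forward_cases)
    case (plain e)
    note post = inv[OF plain(3) plain(5)[unfolded nx_u]]
    show ?thesis
      unfolding main_body_def forward_step_def
      using plain(1,2) B1 B2 ub F Gb[of "Suc j"]
      by (auto simp: st nx_u plain(4)[symmetric] intro!: post)
  next
    case (skip e)
    note post = inv[OF skip(4) skip(6)[unfolded nx_u]]
    show ?thesis
      unfolding main_body_def forward_step_def
      using skip(1,2,3) B1 B2 ub F Gb[of "Suc (Suc j)"]
      by (auto simp: st nx_u skip(5)[symmetric] intro!: post)
  next
    case (skip_last e)
    note post = inv[OF skip_last(4) skip_last(6)[unfolded nx_u]]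
    show ?thesis
      unfolding main_body_def forward_step_def
      using skip_last(1,2,3) B1 B2 ub F
      by (auto simp: st nx_u skip_last(5)[symmetric] intro!: post)
  next
    case (last e)
    note post = inv[OF last(2) last(4)[unfolded nx_u]]
    show ?thesis
      unfolding main_body_def forward_step_def
      using last(1) B1 B2 ub F
      by (auto simp: st nx_u last(3)[symmetric] intro!: post)
  qed
qed

end

lemma main_step:
  assumes "main_inv D v\<^sub>0 k s"
  shows "\<exists>r p. bval D s (Lt (Var Var_c) (Var Var_m)) = Some (r, p) \<and> list_all (affordable D) p \<and>
    (r \<longrightarrow> 0 < k \<and> wp D main_body (main_inv D v\<^sub>0 (k - 1)) s)"
proof -
  obtain b R F where t: "tour D v\<^sub>0 (array s Arr_next) (array s Arr_visited) (array s Arr_skipped)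
        (array s Arr_B) (scalar s Var_u) b R F"
    and st: "scalar s Var_m = num_arcs D" "scalar s Var_v0 = v\<^sub>0" "scalar s Var_c = card F"
    and k: "card R + card F + k = 2 * num_arcs D"
    using assms unfolding main_inv_def by blast
  interpret tour D v\<^sub>0 "array s Arr_next" "array s Arr_visited" "array s Arr_skipped"
    "array s Arr_B" "scalar s Var_u" b R F by (rule t)
  have "0 < k \<and> wp D main_body (main_inv D v\<^sub>0 (k - 1)) s" if "card F < num_arcs D"
  \<comment> \<open>The program tests the pointer after incrementing it, hence the
    \<open>Suc\<close>.\<close>
  proof (cases "Suc (array s Arr_next (scalar s Var_u)) \<le> indeg (scalar s Var_u)")
    case True
    show ?thesis by (rule backward_exec[OF refl refl refl refl refl st(1,2,3) k True])
  next
    case False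
    then show ?thesis
      by (intro forward_exec[OF refl refl refl refl refl st(1,2,3) k _ that]) simp
  qed
  then show ?thesis using card_F_le st by simp
qed

lemma (in ordered_eulerian_digraph) init_step:
  assumes "init_inv D v\<^sub>0 k s"
  shows "\<exists>r p. bval D s (Le (Var Var_j) (Var Var_n)) = Some (r, p) \<and> list_all (affordable D) p \<and>
    (r \<longrightarrow> 0 < k \<and> wp D init_body (init_inv D v\<^sub>0 (k - 1)) s)"
proof -
  note n = num_verts_le_linear
  note inv = assms[unfolded init_inv_def]
  have "0 < k" if "scalar s Var_j \<le> num_verts D" using inv that by linarith
  moreover have "wp D init_body (init_inv D v\<^sub>0 (k - 1)) s" if "scalar s Var_j \<le> num_verts D"
  proof -
    let ?j = "scalar s Var_j"
    \<comment> \<open>The four separate updates clear the cell in every array, because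
      \<open>arr\<close> has just four elements.\<close>
    have upd: "(array s)(Arr_next := (array s Arr_next)(?j := 0),
        Arr_visited := (array s Arr_visited)(?j := 0),
        Arr_skipped := (array s Arr_skipped)(?j := 0), Arr_B := (array s Arr_B)(?j := 0)) =
        (\<lambda>a. (array s a)(?j := 0))"
    proof
      show "((array s)(Arr_next := (array s Arr_next)(?j := 0),
        Arr_visited := (array s Arr_visited)(?j := 0),
        Arr_skipped := (array s Arr_skipped)(?j := 0), Arr_B := (array s Arr_B)(?j := 0))) a =
        (array s a)(?j := 0)" for a by (cases a) simp_all
    qed
    have "init_inv D v\<^sub>0 (k - Suc 0) s'"
      if "scalar s' = (scalar s)(Var_j := Suc ?j)" "array s' = (\<lambda>a. (array s a)(?j := 0))" for s'
      using inv \<open>?j \<le> num_verts D\<close> unfolding init_inv_def that by auto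
    then show ?thesis using inv n that unfolding init_body_def by (auto simp: upd)
  qed
  ultimately show ?thesis using inv n by auto
qed

text \<open>Both trails are empty and all ends are at \<open>v\<^sub>0\<close>, so the indicators in
  the balance equations cancel. Zeros are required at vertices only, since other cells keep
  arbitrary contents.\<close>

lemma (in ordered_eulerian_digraph) tour_init:
  assumes v: "v\<^sub>0 \<in> V" and z: "\<And>a x. x \<in> V \<Longrightarrow> ar a x = (0::nat)"
  shows "tour D v\<^sub>0 (ar Arr_next) ((ar Arr_visited)(v\<^sub>0 := 1)) (ar Arr_skipped) (ar Arr_B) v\<^sub>0 v\<^sub>0 {} {}"
  by unfold_locales (use v z in \<open>auto split: if_splits\<close>)

section \<open>Assembling the time bound\<close>

lemma loop_free_bodies: "loop_free main_body" "loop_free init_body"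
  by (simp_all add: main_body_def init_body_def backward_step_def forward_step_def)

definition init_ops :: nat where
  "init_ops = bops (Le (Var Var_j) (Var Var_n)) + 1 + cops init_body"

definition main_ops :: nat where
  "main_ops = bops (Lt (Var Var_c) (Var Var_m)) + 1 + cops main_body"

text \<open>The potentials start at \<open>n\<close> and \<open>2 * m\<close>, which gives the
  factors \<open>n + 1\<close> and \<open>2 * m + 1\<close>. The first assignment takes 2
  operations, the three between the loops take \<open>2 + 2 + 3 = 7\<close>.\<close>

lemma (in ordered_eulerian_digraph) run_time:
  assumes v: "v\<^sub>0 \<in> V" and s: "initial_state D v\<^sub>0 s"
  shows "wp_within D ((2 + ((num_verts D + 1) * init_ops + 7)) + (2 * num_arcs D + 1) * main_ops)
    space_efficient_hierholzer (\<lambda>_. True) s"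
proof -
  note i = s[unfolded initial_state_def]
  note n = num_verts_le_linear
  let ?c0 = "Assign Var_j (Const 1)"
  let ?c1 = "While (Le (Var Var_j) (Var Var_n)) init_body"
  let ?c2 = "seqs [Assign Var_c (Const 0), Assign Var_u (Var Var_v0),
     AssignElem Arr_visited (Var Var_u) (Const 1)]"
  let ?c3 = "While (Lt (Var Var_c) (Var Var_m)) main_body"
  let ?I1 = "\<lambda>s. (\<exists>k. init_inv D v\<^sub>0 k s) \<and> (\<exists>p. bval D s (Le (Var Var_j) (Var Var_n)) = Some (False, p))"
  have 0: "wp_within D 2 ?c0 (init_inv D v\<^sub>0 (num_verts D)) s"
  proof -
    have "wp D ?c0 (init_inv D v\<^sub>0 (num_verts D)) s" using i by (simp add: init_inv_def)
    from wp_within_loop_free[OF _ this] show ?thesis by (simp add: numeral_2_eq_2)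
  qed
  have 1: "wp_within D ((num_verts D + 1) * init_ops) ?c1 ?I1 s"
    if "init_inv D v\<^sub>0 (num_verts D) s" for s
    unfolding init_ops_def by (rule wp_within_While[OF init_step loop_free_bodies(2) that])
  have 2: "wp_within D 7 ?c2 (main_inv D v\<^sub>0 (2 * num_arcs D)) s" if "?I1 s" for s
  proof -
    have st: "scalar s Var_m = num_arcs D" "scalar s Var_v0 = v\<^sub>0"
      \<comment> \<open>As the guard has failed, \<open>Var_j\<close> exceeds \<open>n\<close>, so
        the cleared range covers all vertices.\<close>
      and z: "\<forall>a. \<forall>x \<in> {1..num_verts D}. array s a x = 0"
      using that by (auto simp: init_inv_def)
    have z: "array s a x = 0" if "x \<in> V" for a x
      using z vert_in_range[OF that] by blast
    have v0: "v\<^sub>0 \<in> {1..num_verts D}" using vert_in_range[OF v] .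
    have "main_inv D v\<^sub>0 (2 * num_arcs D) s'"
      if "array s' = (array s)(Arr_visited := (array s Arr_visited)(v\<^sub>0 := Suc 0))"
        "scalar s' = (scalar s)(Var_c := 0, Var_u := v\<^sub>0)" for s'
      using st tour_init[of v\<^sub>0 "array s", OF v z] unfolding main_inv_def that by force
    then have "wp D ?c2 (main_inv D v\<^sub>0 (2 * num_arcs D)) s"
      using st n v0 by simp
    from wp_within_loop_free[OF _ this] show ?thesis by (simp add: eval_nat_numeral)
  qed
  have 3: "wp_within D ((2 * num_arcs D + 1) * main_ops) ?c3 (\<lambda>_. True) s"
    if "main_inv D v\<^sub>0 (2 * num_arcs D) s" for s
    using wp_within_While[OF main_step loop_free_bodies(1) that]
    unfolding main_ops_def wp_within_def by blast
  have 12: "wp_within D ((num_verts D + 1) * init_ops + 7) (Seq ?c1 ?c2)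
      (main_inv D v\<^sub>0 (2 * num_arcs D)) s" if "init_inv D v\<^sub>0 (num_verts D) s" for s
    by (rule wp_within_Seq[OF 1[OF that] 2])
  have "space_efficient_hierholzer = Seq (Seq ?c0 (Seq ?c1 ?c2)) ?c3"
    by (simp add: space_efficient_hierholzer_def initialise_def main_body_def init_body_def)
  then show ?thesis
    using wp_within_Seq[OF wp_within_Seq[OF 0 12] 3] by (simp only:)
qed

theorem theorem12:
  fixes cost :: "'e ordered_digraph \<Rightarrow> operation \<Rightarrow> nat"
  assumes "constant_time_arithmetic cost"
    and "constant_time_graph_access cost"
  shows "\<exists>K. \<forall>D v\<^sub>0 s. ordered_eulerian D \<longrightarrow> v\<^sub>0 \<in> verts (base D) \<longrightarrow> initial_state D v\<^sub>0 s \<longrightarrow>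
    (\<exists>p s'. exec D space_efficient_hierholzer s p s' \<and>
      running_time cost D p \<le> K * max 1 (num_arcs D))"
proof -
  obtain K where K: "\<And>D op. ordered_eulerian D \<Longrightarrow> affordable D op \<Longrightarrow> cost D op \<le> K"
    using affordable_cost[OF assms] by blast
  \<comment> \<open>With \<open>M = max 1 m\<close>: 9 is \<open>2 + 7\<close>, the factor 2 comes
    from \<open>n + 1 \<le> 2 * M\<close>, and the factor 3 from
    \<open>2 * m + 1 \<le> 3 * M\<close>. None of this depends on the graph.\<close>
  let ?C = "9 + 2 * init_ops + 3 * main_ops"
  have "\<exists>p s'. exec D space_efficient_hierholzer s p s' \<and>
      running_time cost D p \<le> K * ?C * max 1 (num_arcs D)"
    if D: "ordered_eulerian D" and v: "v\<^sub>0 \<in> verts (base D)" and s: "initial_state D v\<^sub>0 s" for D v\<^sub>0 s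
  proof -
    interpret ordered_eulerian_digraph D by unfold_locales (rule D)
    let ?M = "max 1 (num_arcs D)"
    obtain p s' where p: "exec D space_efficient_hierholzer s p s'" "list_all (affordable D) p"
      and len: "length p \<le> (2 + ((num_verts D + 1) * init_ops + 7)) + (2 * num_arcs D + 1) * main_ops"
      using run_time[OF v s] unfolding wp_within_def by blast
    have "(num_verts D + 1) * init_ops \<le> (2 * ?M) * init_ops"
      using num_verts_le by (intro mult_right_mono) auto
    moreover have "(2 * num_arcs D + 1) * main_ops \<le> (3 * ?M) * main_ops"
      by (intro mult_right_mono) auto
    moreover have "9 \<le> 9 * ?M" by simp
    ultimately have "length p \<le> 9 * ?M + (2 * ?M) * init_ops + (3 * ?M) * main_ops"
      using len by linarith
    also have "\<dots> = ?C * ?M" by (simp add: algebra_simps)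
    finally have "K * length p \<le> K * ?C * ?M" by (simp add: mult.assoc)
    moreover have "running_time cost D p \<le> K * length p"
      using p(2) unfolding running_time_def
      by (induction p) (auto simp: add_mono K[OF D])
    ultimately show ?thesis using p(1) by (meson order_trans)
  qed
  then show ?thesis by blast
qed

end
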